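(* Assume the following hypothesis (the "$\Delta$-Conjecture"): for every irregular prime $p$, (i) $\Delta_{(p,l)}\neq 0$ for every irregular pair $(p,l)\in\Psi^{\rm irr}_1$; (ii) $i_1(p)=i_2(p)=i_3(p)=\cdots$; (iii) for every $(p,l)\in\Psi^{\rm irr}_1$ the $p$-adic zeta function $\zeta_{p,l}$ has a unique zero $\chi_{(p,l)}$ in $\mathbb{Z}_p$; (iv) for every $(p,l)\in\Psi^{\rm irr}_1$ and all $s,t\in\mathbb{Z}_p$ one has $|\zeta_{p,l}(s)-\zeta_{p,l}(t)|_p=|p\,(s-t)|_p$. Then for every even positive integer $n$, \[ B_n=(-1)^{\frac n2-1}\prod_{p-1\nmid n}|n|_p^{-1}\prod_{\substack{(p,l)\in\Psi^{\rm irr}_1\\ n\equiv l \ (\mathrm{mod}\ p-1)}}\Big|p\,\Big(\chi_{(p,l)}-\tfrac{n-l}{p-1}\Big)\Big|_p^{-1}\prod_{p-1\mid n}p^{-1}, \] where all products run over primes $p$.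
   Context: $B_n$ are the Bernoulli numbers, $\frac{z}{e^z-1}=\sum_{n\ge0}B_n\frac{z^n}{n!}$. $\varphi$ is Euler's totient function; $|x|_p=p^{-\mathrm{ord}_p x}$ is the $p$-adic absolute value. An odd prime $p$ is irregular if $p$ divides some $B_k$ with $k\in\{2,4,\dots,p-3\}$. For $n\ge1$, the set of irregular pairs of order $n$ is $\Psi^{\rm irr}_n=\{(p,l): p \text{ an odd prime},\ p^n\mid B_l/l,\ 2\le l<\varphi(p^n),\ l \text{ even}\}$ (here $p^n\mid B_l/l$ means $B_l/l$ is a rational number with $p$-adic valuation at least $n$), and $i_n(p)=\#\{l:(p,l)\in\Psi^{\rm irr}_n\}$. A pair $(p,l)\in\Psi^{\rm irr}_n$ is written in $p$-adic notation as $(p,s_1,\dots,s_n)$ where $l=\sum_{\nu=1}^n s_\nu\varphi(p^{\nu-1})$, $0\le s_\nu<p$, $s_1$ even with $2\le s_1\le p-3$; the set of such tuples is $\widehat\Psi^{\rm irr}_n$. For $(p,l)\in\Psi^{\rm irr}_n$, $\Delta_{(p,l)}\in\{0,\dots,p-1\}$ is defined by $\Delta_{(p,l)}\equiv p^{-n}\big(\frac{B_{l+\varphi(p^n)}}{l+\varphi(p^n)}-\frac{B_l}{l}\big)\pmod p$. For a prime $p\ge5$ and fixed even $s_1\in\{2,\dots,p-3\}$, the $p$-adic zeta function $\zeta_{p,s_1}:\mathbb{Z}_p\to\mathbb{Z}_p$ is $\zeta_{p,s_1}(s)=\lim_{t_\nu\to s}(1-p^{m_\nu-1})\big(-\frac{B_{m_\nu}}{m_\nu}\big)$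 with $m_\nu=s_1+(p-1)t_\nu$, for any sequence of nonnegative integers $t_\nu$ converging $p$-adically to $s$. When $(p,l)\in\Psi^{\rm irr}_1$ with $\Delta_{(p,l)}\neq0$, it is known that there is a unique sequence $(s_\nu)_{\nu\ge1}$ with $s_1=l$ and $(p,s_1,\dots,s_n)\in\widehat\Psi^{\rm irr}_n$ for all $n\ge1$; then $\chi_{(p,l)}:=\sum_{\nu\ge0}s_{\nu+2}p^\nu\in\mathbb{Z}_p$ (this is the zero in (iii)). *)

theory Defs
  imports
    Complex_Main
    "HOL-Library.Groups_Big_Fun"
    "HOL-Computational_Algebra.Formal_Power_Series"
    "HOL-Number_Theory.Totient"
    "HOL-Number_Theory.Modular_Inverse"
    "HOL-Algebra.Ring"
begin

section \<open>Bernoulli numbers\<close>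

definition bernoulli :: "nat \<Rightarrow> rat" where
  "bernoulli n = fact n * fps_nth (fps_X / (fps_exp 1 - 1)) n"

section \<open>The p-adic valuation on the rationals\<close>

text \<open>The value at \<open>r = 0\<close> is junk; \<open>padic_abs_rat\<close> and \<open>ppow_dvd_rat\<close> treat \<open>0\<close> separately.\<close>

definition padic_ord_rat :: "nat \<Rightarrow> rat \<Rightarrow> int" where
  "padic_ord_rat p r =
     int (multiplicity (int p) (fst (quotient_of r))) -
     int (multiplicity (int p) (snd (quotient_of r)))"

definition padic_abs_rat :: "nat \<Rightarrow> rat \<Rightarrow> real" where
  "padic_abs_rat p r = (if r = 0 then 0 else real p powi (- padic_ord_rat p r))"

text \<open>\<open>ppow_dvd_rat p n r\<close> is the divisibility of the rational number \<open>r\<close> by \<open>p ^ n\<close> at \<open>p\<close>.\<close>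

definition ppow_dvd_rat :: "nat \<Rightarrow> nat \<Rightarrow> rat \<Rightarrow> bool" where
  "ppow_dvd_rat p n r \<longleftrightarrow> r = 0 \<or> int n \<le> padic_ord_rat p r"

section \<open>The ring of p-adic integers\<close>

text \<open>
  A \<open>p\<close>-adic integer is a compatible system of residues: \<open>x n\<close> is its residue modulo \<open>p ^ n\<close>,
  normalised to lie between \<open>0\<close> and \<open>p ^ n - 1\<close>.
\<close>

definition Zp :: "nat \<Rightarrow> (nat \<Rightarrow> int) ring" where
  "Zp p = \<lparr>carrier = {x. \<forall>n. x n \<in> {0..<int p ^ n} \<and> x (Suc n) mod int p ^ n = x n},
           monoid.mult = (\<lambda>x y n. (x n * y n) mod int p ^ n),
           one = (\<lambda>n. 1 mod int p ^ n),
           zero = (\<lambda>n. 0),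
           add = (\<lambda>x y n. (x n + y n) mod int p ^ n)\<rparr>"

lemma Zp_simps:
  "x \<in> carrier (Zp p) \<longleftrightarrow> (\<forall>n. 0 \<le> x n \<and> x n < int p ^ n \<and> x (Suc n) mod int p ^ n = x n)"
  "x \<otimes>\<^bsub>Zp p\<^esub> y = (\<lambda>n. (x n * y n) mod int p ^ n)"
  "\<one>\<^bsub>Zp p\<^esub> = (\<lambda>n. 1 mod int p ^ n)"
  "\<zero>\<^bsub>Zp p\<^esub> = (\<lambda>n. 0)"
  "x \<oplus>\<^bsub>Zp p\<^esub> y = (\<lambda>n. (x n + y n) mod int p ^ n)"
  by (auto simp: Zp_def)

lemma Zp_carrierI:
  assumes "p > 0" "\<And>n. a (Suc n) mod int p ^ n = a n mod int p ^ n"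
  shows "(\<lambda>n. a n mod int p ^ n) \<in> carrier (Zp p)"
proof -
  have "a (Suc n) mod int p ^ Suc n mod int p ^ n = a n mod int p ^ n" for n
    using assms(2)[of n] by (simp add: mod_mod_cancel)
  with assms(1) show ?thesis
    by (simp add: Zp_simps del: power_Suc)
qed

lemma cring_Zp:
  assumes "p > 0"
  shows "cring (Zp p)"
proof -
  have carrierD: "x n mod int p ^ n = x n" "x (Suc n) mod int p ^ n = x n mod int p ^ n"
    if "x \<in> carrier (Zp p)" for x n
    using that by (simp_all add: Zp_simps)
  show ?thesis
  proof (rule cringI)
    show "abelian_group (Zp p)"
    proof (rule abelian_groupI)
      fix x y assume *: "x \<in> carrier (Zp p)" "y \<in> carrier (Zp p)"
      show "x \<oplus>\<^bsub>Zp p\<^esub> y \<in> carrier (Zp p)"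
        unfolding Zp_simps(5) by (rule Zp_carrierI[OF assms], rule mod_add_cong) (use * carrierD in auto)
    next
      show "\<zero>\<^bsub>Zp p\<^esub> \<in> carrier (Zp p)"
        using assms by (simp add: Zp_simps)
    next
      fix x y z
      show "x \<oplus>\<^bsub>Zp p\<^esub> y \<oplus>\<^bsub>Zp p\<^esub> z = x \<oplus>\<^bsub>Zp p\<^esub> (y \<oplus>\<^bsub>Zp p\<^esub> z)"
        by (simp only: Zp_simps mod_add_left_eq mod_add_right_eq add.assoc)
      show "x \<oplus>\<^bsub>Zp p\<^esub> y = y \<oplus>\<^bsub>Zp p\<^esub> x"
        by (simp only: Zp_simps add.commute)
    next
      fix x assume *: "x \<in> carrier (Zp p)"
      show "\<zero>\<^bsub>Zp p\<^esub> \<oplus>\<^bsub>Zp p\<^esub> x = x"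
        by (simp only: Zp_simps(4,5) carrierD(1)[OF *] add_0)
      have "(\<lambda>n. (- x n) mod int p ^ n) \<in> carrier (Zp p)"
        by (rule Zp_carrierI[OF assms], rule mod_minus_cong) (use * carrierD in auto)
      moreover have "(\<lambda>n. (- x n) mod int p ^ n) \<oplus>\<^bsub>Zp p\<^esub> x = \<zero>\<^bsub>Zp p\<^esub>"
        by (simp only: Zp_simps(4,5) mod_add_left_eq) simp
      ultimately show "\<exists>y\<in>carrier (Zp p). y \<oplus>\<^bsub>Zp p\<^esub> x = \<zero>\<^bsub>Zp p\<^esub>" by blast
    qed
    show "comm_monoid (Zp p)"
    proof (rule comm_monoidI)
      fix x y assume *: "x \<in> carrier (Zp p)" "y \<in> carrier (Zp p)"
      show "x \<otimes>\<^bsub>Zp p\<^esub> y \<in> carrier (Zp p)"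
        unfolding Zp_simps(2) by (rule Zp_carrierI[OF assms], rule mod_mult_cong) (use * carrierD in auto)
    next
      show "\<one>\<^bsub>Zp p\<^esub> \<in> carrier (Zp p)"
        unfolding Zp_simps(3) by (rule Zp_carrierI[OF assms]) (rule refl)
    next
      fix x y z
      show "x \<otimes>\<^bsub>Zp p\<^esub> y \<otimes>\<^bsub>Zp p\<^esub> z = x \<otimes>\<^bsub>Zp p\<^esub> (y \<otimes>\<^bsub>Zp p\<^esub> z)"
        by (simp only: Zp_simps mod_mult_left_eq mod_mult_right_eq mult.assoc)
      show "x \<otimes>\<^bsub>Zp p\<^esub> y = y \<otimes>\<^bsub>Zp p\<^esub> x"
        by (simp only: Zp_simps mult.commute)
    next
      fix x assume *: "x \<in> carrier (Zp p)"
      show "\<one>\<^bsub>Zp p\<^esub> \<otimes>\<^bsub>Zp p\<^esub> x = x"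
        by (simp only: Zp_simps(2,3) mod_mult_left_eq mult_1 carrierD(1)[OF *])
    qed
    fix x y z
    show "(x \<oplus>\<^bsub>Zp p\<^esub> y) \<otimes>\<^bsub>Zp p\<^esub> z = x \<otimes>\<^bsub>Zp p\<^esub> z \<oplus>\<^bsub>Zp p\<^esub> y \<otimes>\<^bsub>Zp p\<^esub> z"
      by (simp only: Zp_simps mod_mult_left_eq mod_add_eq distrib_right)
  qed
qed

lemma Zp_minus:
  assumes "p > 0" "x \<in> carrier (Zp p)" "y \<in> carrier (Zp p)"
  shows "x \<ominus>\<^bsub>Zp p\<^esub> y = (\<lambda>n. (x n - y n) mod int p ^ n)"
proof -
  interpret cring "Zp p" by (rule cring_Zp[OF assms(1)])
  have "(\<lambda>n. (x n - y n) mod int p ^ n) \<in> carrier (Zp p)"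
    by (rule Zp_carrierI[OF assms(1)], rule mod_diff_cong) (use assms in \<open>auto simp: Zp_simps\<close>)
  moreover have "(\<lambda>n. (x n - y n) mod int p ^ n) \<oplus>\<^bsub>Zp p\<^esub> y = x"
    using assms(2) by (simp add: Zp_simps mod_add_left_eq)
  ultimately show ?thesis
    using assms(2,3) a_assoc a_comm minus_eq r_neg1 by (metis add.inv_closed)
qed

text \<open>For \<open>x \<noteq> 0\<close>, the least \<open>n\<close> with \<open>x (Suc n) \<noteq> 0\<close> is the largest \<open>n\<close> such that \<open>p ^ n\<close> divides \<open>x\<close>.\<close>

definition padic_ord :: "(nat \<Rightarrow> int) \<Rightarrow> nat" where
  "padic_ord x = (LEAST n. x (Suc n) \<noteq> 0)"

definition padic_abs :: "nat \<Rightarrow> (nat \<Rightarrow> int) \<Rightarrow> real" where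
  "padic_abs p x = (if x = \<zero>\<^bsub>Zp p\<^esub> then 0 else real p powi (- int (padic_ord x)))"

text \<open>
  The embedding of the rational numbers whose denominator is prime to \<open>p\<close>
  (junk for all other rational numbers).
\<close>

definition padic_of_rat :: "nat \<Rightarrow> rat \<Rightarrow> (nat \<Rightarrow> int)" where
  "padic_of_rat p r =
     (\<lambda>n. fst (quotient_of r) * modular_inverse (int p ^ n) (snd (quotient_of r)) mod int p ^ n)"

definition padic_tendsto :: "nat \<Rightarrow> (nat \<Rightarrow> (nat \<Rightarrow> int)) \<Rightarrow> (nat \<Rightarrow> int) \<Rightarrow> bool" where
  "padic_tendsto p X x \<longleftrightarrow> (\<lambda>\<nu>. padic_abs p (X \<nu> \<ominus>\<^bsub>Zp p\<^esub> x)) \<longlonglongrightarrow> 0"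

text \<open>The \<open>p\<close>-adic integer \<open>\<Sum>\<nu>. a \<nu> * p ^ \<nu>\<close>: terms with \<open>\<nu> \<ge> N\<close> vanish modulo \<open>p ^ N\<close>.\<close>

definition padic_series :: "nat \<Rightarrow> (nat \<Rightarrow> nat) \<Rightarrow> (nat \<Rightarrow> int)" where
  "padic_series p a = (\<lambda>N. (\<Sum>\<nu><N. int (a \<nu>) * int p ^ \<nu>) mod int p ^ N)"

section \<open>Irregular primes and irregular pairs\<close>

definition irregular_prime :: "nat \<Rightarrow> bool" where
  "irregular_prime p \<longleftrightarrow> prime p \<and> odd p \<and>
     (\<exists>k. even k \<and> 2 \<le> k \<and> k \<le> p - 3 \<and> ppow_dvd_rat p 1 (bernoulli k))"

definition irregular_pairs :: "nat \<Rightarrow> (nat \<times> nat) set" where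
  "irregular_pairs n = {(p, l). prime p \<and> odd p \<and> ppow_dvd_rat p n (bernoulli l / of_nat l) \<and>
     2 \<le> l \<and> l < totient (p ^ n) \<and> even l}"

definition irregularity_index :: "nat \<Rightarrow> nat \<Rightarrow> nat" where
  "irregularity_index n p = card {l. (p, l) \<in> irregular_pairs n}"

text \<open>
  Irregular pairs of order \<open>n\<close> in \<open>p\<close>-adic notation. Lists are indexed from \<open>0\<close>, so
  \<open>s ! \<nu>\<close> is the digit usually called \<open>s\<^sub>\<nu>\<^sub>+\<^sub>1\<close>.
\<close>

definition irregular_pairs_padic :: "nat \<Rightarrow> (nat \<times> nat list) set" where
  "irregular_pairs_padic n = {(p, s). length s = n \<and> (\<forall>\<nu><n. s ! \<nu> < p) \<and>
     even (s ! 0) \<and> 2 \<le> s ! 0 \<and> s ! 0 \<le> p - 3 \<and>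
     (p, \<Sum>\<nu><n. s ! \<nu> * totient (p ^ \<nu>)) \<in> irregular_pairs n}"

text \<open>The residue \<open>\<Delta>\<close> of \<open>(p, l)\<close>, regarded as an irregular pair of order \<open>n\<close>.\<close>

definition irregular_Delta :: "nat \<Rightarrow> nat \<Rightarrow> nat \<Rightarrow> nat" where
  "irregular_Delta n p l = (THE d. d < p \<and>
     ppow_dvd_rat p 1
       ((bernoulli (l + totient (p ^ n)) / of_nat (l + totient (p ^ n))
           - bernoulli l / of_nat l) / of_nat p ^ n - of_nat d))"

section \<open>The p-adic zeta functions and their zeros\<close>

definition padic_zeta :: "nat \<Rightarrow> nat \<Rightarrow> (nat \<Rightarrow> int) \<Rightarrow> (nat \<Rightarrow> int)" where
  "padic_zeta p s1 s = (THE z. z \<in> carrier (Zp p) \<and>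
     (\<forall>t::nat \<Rightarrow> nat. padic_tendsto p (\<lambda>\<nu>. padic_of_rat p (of_nat (t \<nu>))) s \<longrightarrow>
        padic_tendsto p
          (\<lambda>\<nu>. let m = s1 + (p - 1) * t \<nu>
                in padic_of_rat p ((1 - of_nat p ^ (m - 1)) * (- (bernoulli m / of_nat m)))) z))"

text \<open>As above, \<open>irregular_digits p l \<nu>\<close> is the digit usually called \<open>s\<^sub>\<nu>\<^sub>+\<^sub>1\<close>.\<close>

definition irregular_digits :: "nat \<Rightarrow> nat \<Rightarrow> nat \<Rightarrow> nat" where
  "irregular_digits p l = (THE s. s 0 = l \<and>
     (\<forall>n\<ge>1. (p, map s [0..<n]) \<in> irregular_pairs_padic n))"

definition irregular_chi :: "nat \<Rightarrow> nat \<Rightarrow> (nat \<Rightarrow> int)" where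
  "irregular_chi p l = padic_series p (\<lambda>\<nu>. irregular_digits p l (\<nu> + 1))"

end

(*
  The product formula reduces the theorem to the sign of B_n and to the absolute values |B_n|_p.

  If p - 1 divides n, then |B_n|_p = p by von Staudt and Clausen, because p B_n is the p-adic limit
  of p^(1-k) * (sum of j^n over j < p^k), which is -1 modulo p.

  If p - 1 does not divide n, let l = n mod (p - 1). Voronoi's congruence writes (a^m - 1) B_m / m as a
  p-adic limit of the integers sum_{j < N} (j a)^(m-1) * floor(j a / N) with N = p^k; leaving out the
  multiples of p amounts to the Euler factor 1 - p^(m-1), and Kummer's congruences follow from
  Euler's theorem applied term by term. Hence B_n / n is a p-adic unit unless (p, l) is an irregular
  pair, and in that case - (1 - p^(n-1)) B_n / n is the value of the zeta function at
  t = (n - l) / (p - 1); comparing this value with the zero chi by means of the isometry (iv) gives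
  |B_n / n|_p = |p (chi - t)|_p.
*)
theory Submission
  imports Defs "HOL-Number_Theory.Residue_Primitive_Roots"
begin

unbundle fps_syntax


section \<open>Valuations of rational numbers\<close>

text \<open>Power sums approximate B_m, but give poor control of B_m / m when p divides m, and it is
  B_m / m, with its Euler factor, that varies p-adically continuously. Voronoi's sums consist of
  integers and tend to (a^m - 1) B_m / m itself, so integrality and congruences come out together.
  The price is the factor a^m - 1; a primitive root a modulo p makes it a p-adic unit unless p - 1
  divides m, which is why that case needs another argument. Both kinds of limit are handled without
  p-adic analysis: a limit along N = p^k means that one nonzero integer d, independent of k, turns
  the error into a multiple of p^k, and congruences between rationals are
  \<open>ppow_dvd_rat\<close> statements. Genuine p-adic integers enter only through the zeta
  function, and its values are computed only at natural numbers, because n - l is a multiple of p -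
  1.\<close>

lemma padic_ord_rat_divide:
  assumes p: "prime p" and "a \<noteq> 0" "b \<noteq> 0"
  shows "padic_ord_rat p (of_int a / of_int b) =
    int (multiplicity (int p) a) - int (multiplicity (int p) b)"
proof -
  obtain u v where uv: "quotient_of (of_int a / of_int b) = (u, v)"
    by force
  have "v > 0" and eq: "of_int a / of_int b = (of_int u / of_int v :: rat)"
    using uv quotient_of_denom_pos quotient_of_div by blast+
  \<comment> \<open>The valuation is defined through the reduced fraction u / v;
    cross-multiplication transfers it to an arbitrary representation.\<close>
  then have "(of_int (a * v) :: rat) = of_int (u * b)"
    using assms by (simp add: field_simps)
  then have eq': "a * v = u * b"
    by (simp only: of_int_eq_iff)
  have "u \<noteq> 0"
    using eq' assms \<open>v > 0\<close> by auto
  have "multiplicity (int p) (a * v) = multiplicity (int p) (u * b)"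
    by (simp add: eq')
  then have "multiplicity (int p) a + multiplicity (int p) v =
      multiplicity (int p) u + multiplicity (int p) b"
    using assms \<open>u \<noteq> 0\<close> \<open>v > 0\<close> by (simp add: prime_elem_multiplicity_mult_distrib)
  then show ?thesis
    unfolding padic_ord_rat_def uv by simp
qed

lemma rat_as_fraction:
  fixes r :: rat
  obtains a b :: int where "r = of_int a / of_int b" "b > 0" "coprime a b"
proof (cases "quotient_of r")
  case (Pair a b)
  then show ?thesis
    using that quotient_of_coprime quotient_of_denom_pos quotient_of_div by blast
qed

lemma padic_ord_rat_mult:
  assumes p: "prime p" and "r \<noteq> 0" "s \<noteq> 0"
  shows "padic_ord_rat p (r * s) = padic_ord_rat p r + padic_ord_rat p s"
proof -
  obtain a b where r: "r = of_int a / of_int b" "b > 0"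
    by (rule rat_as_fraction)
  obtain c d where s: "s = of_int c / of_int d" "d > 0"
    by (rule rat_as_fraction)
  have nz: "a \<noteq> 0" "b \<noteq> 0" "c \<noteq> 0" "d \<noteq> 0"
    using r s assms by auto
  have "r * s = of_int (a * c) / of_int (b * d)"
    using r s by simp
  then have "padic_ord_rat p (r * s) =
      int (multiplicity (int p) (a * c)) - int (multiplicity (int p) (b * d))"
    using padic_ord_rat_divide[OF p, of "a * c" "b * d"] nz by simp
  also have "\<dots> = padic_ord_rat p r + padic_ord_rat p s"
    using p nz padic_ord_rat_divide[OF p, of a b] padic_ord_rat_divide[OF p, of c d]
    by (simp add: r s prime_elem_multiplicity_mult_distrib)
  finally show ?thesis .
qed

lemma padic_ord_rat_of_int:
  assumes "prime p" "a \<noteq> 0"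
  shows "padic_ord_rat p (of_int a) = int (multiplicity (int p) a)"
  using padic_ord_rat_divide[OF assms, of 1] by simp

lemma padic_abs_rat_mult:
  assumes "prime p"
  shows "padic_abs_rat p (r * s) = padic_abs_rat p r * padic_abs_rat p s"
proof (cases "r = 0 \<or> s = 0")
  case False
  then have "- padic_ord_rat p (r * s) = - padic_ord_rat p r + - padic_ord_rat p s"
    using assms by (simp add: padic_ord_rat_mult)
  with False show ?thesis
    using prime_gt_0_nat[OF assms] by (simp add: padic_abs_rat_def flip: power_int_add)
qed (auto simp: padic_abs_rat_def)

section \<open>Congruences between rational numbers modulo prime powers\<close>

text \<open>Reduced fractions are awkward under addition; an integer equation with a multiplier
  prime to p is not. As \<open>e\<close> is a natural number, divisibility by p^e forces the reduced
  denominator to be prime to p. For e = 0 the condition is p-integrality.\<close>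

lemma ppow_dvd_rat_iff:
  assumes p: "prime p"
  shows "ppow_dvd_rat p e r \<longleftrightarrow>
    (\<exists>a b :: int. \<not> int p dvd b \<and> r * of_int b = of_nat p ^ e * of_int a)"
proof (cases "r = 0")
  case True
  with p have "\<not> int p dvd 1" "r * of_int 1 = of_nat p ^ e * of_int 0"
    by auto
  with True show ?thesis
    unfolding ppow_dvd_rat_def by blast
next
  case False
  obtain u v where r: "r = of_int u / of_int v" "v > 0" and cop: "coprime u v"
    by (rule rat_as_fraction)
  have nz: "u \<noteq> 0" "v \<noteq> 0"
    using False r by auto
  have pp: "prime (int p)"
    using p by simp
  have ord: "padic_ord_rat p r = int (multiplicity (int p) u) - int (multiplicity (int p) v)"
    using padic_ord_rat_divide[OF p nz] r by simp
  show ?thesis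
  proof
    assume "ppow_dvd_rat p e r"
    then have le: "e + multiplicity (int p) v \<le> multiplicity (int p) u"
      using False ord by (simp add: ppow_dvd_rat_def)
    have "\<not> int p dvd v"
    proof
      assume *: "int p dvd v"
      then have "multiplicity (int p) v > 0"
        using nz pp by (simp add: prime_multiplicity_gt_zero_iff)
      then have "int p dvd u"
        using le not_dvd_imp_multiplicity_0 by fastforce
      with * cop pp show False
        using coprime_common_divisor not_prime_unit by blast
    qed
    moreover have "int p ^ e dvd u"
      using le by (intro multiplicity_dvd') simp
    then obtain a where "u = int p ^ e * a" ..
    then have "r * of_int v = of_nat p ^ e * of_int a"
      using nz r by simp
    ultimately show "\<exists>a b :: int. \<not> int p dvd b \<and> r * of_int b = of_nat p ^ e * of_int a"
      by blast
  next
    assume "\<exists>a b :: int. \<not> int p dvd b \<and> r * of_int b = of_nat p ^ e * of_int a"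
    then obtain a b :: int where b: "\<not> int p dvd b" and eq: "r * of_int b = of_nat p ^ e * of_int a"
      by blast
    from eq have "(of_int (u * b) :: rat) = of_int (int p ^ e * a * v)"
      using r nz by (simp add: field_simps)
    then have eq': "u * b = int p ^ e * a * v"
      by (simp only: of_int_eq_iff)
    have "b \<noteq> 0"
      using b by auto
    then have "a \<noteq> 0"
      using eq' nz by auto
    have "multiplicity (int p) (u * b) = multiplicity (int p) (int p ^ e * a * v)"
      using eq' by simp
    then have "multiplicity (int p) u = e + multiplicity (int p) a + multiplicity (int p) v"
      using nz \<open>a \<noteq> 0\<close> \<open>b \<noteq> 0\<close> pp b
      by (simp add: prime_elem_multiplicity_mult_distrib prime_elem_multiplicity_power_distrib
          not_dvd_imp_multiplicity_0)
    then show "ppow_dvd_rat p e r"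
      using ord by (simp add: ppow_dvd_rat_def)
  qed
qed

lemma ppow_dvd_ratI:
  assumes "prime p" "\<not> int p dvd b" "r * of_int b = of_nat p ^ e * of_int a"
  shows "ppow_dvd_rat p e r"
  using assms ppow_dvd_rat_iff by blast

lemma ppow_dvd_rat_0 [simp]: "ppow_dvd_rat p e 0"
  by (simp add: ppow_dvd_rat_def)

lemma ppow_dvd_rat_antimono: "ppow_dvd_rat p e r \<Longrightarrow> e' \<le> e \<Longrightarrow> ppow_dvd_rat p e' r"
  by (auto simp: ppow_dvd_rat_def)

lemma ppow_dvd_rat_of_int_iff:
  assumes "prime p"
  shows "ppow_dvd_rat p e (of_int a) \<longleftrightarrow> int p ^ e dvd a"
proof (cases "a = 0")
  case False
  with assms have "int p ^ e dvd a \<longleftrightarrow> e \<le> multiplicity (int p) a"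
    by (intro power_dvd_iff_le_multiplicity) (auto dest: not_prime_unit)
  with False assms show ?thesis
    by (simp add: ppow_dvd_rat_def padic_ord_rat_of_int)
qed simp

lemma ppow_dvd_rat_add:
  assumes p: "prime p" and "ppow_dvd_rat p e r" "ppow_dvd_rat p e s"
  shows "ppow_dvd_rat p e (r + s)"
proof -
  obtain a b c d :: int where
    "\<not> int p dvd b" "r * of_int b = of_nat p ^ e * of_int a"
    "\<not> int p dvd d" "s * of_int d = of_nat p ^ e * of_int c"
    using assms by (auto simp: ppow_dvd_rat_iff)
  then have "\<not> int p dvd b * d" "(r + s) * of_int (b * d) = of_nat p ^ e * of_int (a * d + c * b)"
    using p by (auto simp: prime_dvd_mult_iff) (simp add: algebra_simps)
  then show ?thesis
    by (rule ppow_dvd_ratI[OF p])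
qed

lemma ppow_dvd_rat_mult:
  assumes p: "prime p" and "ppow_dvd_rat p e r" "ppow_dvd_rat p f s"
  shows "ppow_dvd_rat p (e + f) (r * s)"
proof (cases "r = 0 \<or> s = 0")
  case False
  with assms padic_ord_rat_mult[OF p, of r s] show ?thesis
    by (simp add: ppow_dvd_rat_def)
qed auto

lemma ppow_dvd_rat_minus_iff [simp]:
  assumes p: "prime p"
  shows "ppow_dvd_rat p e (- r) \<longleftrightarrow> ppow_dvd_rat p e r"
proof -
  have "ppow_dvd_rat p 0 (of_int (- 1))"
    by (subst ppow_dvd_rat_of_int_iff[OF p]) simp
  from ppow_dvd_rat_mult[OF p this, of e r] ppow_dvd_rat_mult[OF p this, of e "- r"]
  show ?thesis
    by auto
qed

lemma ppow_dvd_rat_diff: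
  assumes p: "prime p" and "ppow_dvd_rat p e r" "ppow_dvd_rat p e s"
  shows "ppow_dvd_rat p e (r - s)"
proof -
  have "ppow_dvd_rat p e (- s)"
    using assms(3) by (simp only: ppow_dvd_rat_minus_iff[OF p])
  from ppow_dvd_rat_add[OF p assms(2) this] show ?thesis
    by (simp only: add_uminus_conv_diff)
qed

lemma ppow_dvd_rat_diff_iff:
  assumes p: "prime p" and "ppow_dvd_rat p e (r - s)"
  shows "ppow_dvd_rat p e r \<longleftrightarrow> ppow_dvd_rat p e s"
proof
  assume "ppow_dvd_rat p e r"
  from ppow_dvd_rat_diff[OF p this assms(2)] show "ppow_dvd_rat p e s"
    by (simp only: diff_diff_eq2 add_diff_cancel_left')
next
  assume "ppow_dvd_rat p e s"
  from ppow_dvd_rat_add[OF p assms(2) this] show "ppow_dvd_rat p e r"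
    by (simp only: diff_add_cancel)
qed

lemma ppow_dvd_rat_int_mult_iff:
  assumes p: "prime p" and c: "\<not> int p dvd c"
  shows "ppow_dvd_rat p e (of_int c * r) \<longleftrightarrow> ppow_dvd_rat p e r"
proof (cases "r = 0")
  case False
  from c have "c \<noteq> 0"
    by auto
  with False c p show ?thesis
    by (simp add: ppow_dvd_rat_def padic_ord_rat_mult padic_ord_rat_of_int not_dvd_imp_multiplicity_0)
qed simp

text \<open>The constant \<open>d\<close> only costs a bounded power of \<open>p\<close>.\<close>

lemma eventually_ppow_dvd_rat:
  assumes p: "prime p" and d: "d \<noteq> 0"
    and dvd: "\<And>k. \<exists>z::int. of_int d * f k = of_nat p ^ k * of_int z"
  shows "\<forall>\<^sub>F k in sequentially. ppow_dvd_rat p e (f k)"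
  unfolding eventually_sequentially
proof (intro exI allI impI)
  fix k
  assume k: "k \<ge> e + multiplicity (int p) d"
  obtain z where z: "of_int d * f k = of_nat p ^ k * of_int z"
    using dvd by blast
  then have fk: "ppow_dvd_rat p k (of_int d * f k)"
    by (intro ppow_dvd_ratI[OF p, of 1 _ _ z]) (use p in auto)
  show "ppow_dvd_rat p e (f k)"
  proof (cases "f k = 0")
    case False
    have "int k \<le> int (multiplicity (int p) d) + padic_ord_rat p (f k)"
      using fk p d False by (simp add: ppow_dvd_rat_def padic_ord_rat_mult padic_ord_rat_of_int)
    then show ?thesis
      using k by (simp add: ppow_dvd_rat_def)
  qed simp
qed

text \<open>The product formula, solved for the archimedean absolute value. \<open>F\<close> may be
  any finite set of primes that contains the support, so that several products can share one index
  set.\<close>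

lemma prod_prime_powi_padic_ord_rat:
  assumes r: "r \<noteq> 0" and F: "finite F" "\<And>p. p \<in> F \<Longrightarrow> prime p"
    and supp: "\<And>p. prime p \<Longrightarrow> padic_ord_rat p r \<noteq> 0 \<Longrightarrow> p \<in> F"
  shows "of_rat \<bar>r\<bar> = (\<Prod>p\<in>F. inverse (padic_abs_rat p r))"
proof -
  obtain a b where ab: "r = of_int a / of_int b" "b > 0" "coprime a b"
    by (rule rat_as_fraction)
  have nz: "a \<noteq> 0" "b \<noteq> 0"
    using ab r by auto
  have ord: "padic_ord_rat p r = int (multiplicity (int p) a) - int (multiplicity (int p) b)"
    if "prime p" for p
    using padic_ord_rat_divide[OF that nz] ab by simp
  have mult: "multiplicity (int p) x = multiplicity p (nat \<bar>x\<bar>)" for p and x :: int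
    unfolding multiplicity_def by (simp del: of_nat_power add: of_nat_power[symmetric])
  \<comment> \<open>Coprimality rules out cancellation, so every prime factor of the numerator or
    the denominator is visible in the valuation.\<close>
  have mem: "p \<in> F" if p: "prime p" and "p dvd nat \<bar>a\<bar> \<or> p dvd nat \<bar>b\<bar>" for p
  proof (rule supp[OF p])
    have "int p dvd a \<or> int p dvd b"
      using that by auto
    moreover have "\<not> (int p dvd a \<and> int p dvd b)"
      using coprime_common_divisor[OF ab(3), of "int p"] p by (auto dest: prime_gt_1_nat)
    moreover have m0: "multiplicity (int p) x = 0 \<longleftrightarrow> \<not> int p dvd x" if "x \<noteq> 0" for x
      using that p by (subst multiplicity_eq_zero_iff) (auto dest: prime_gt_1_nat)
    ultimately show "padic_ord_rat p r \<noteq> 0"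
      using m0[OF nz(1)] m0[OF nz(2)] by (auto simp: ord[OF p])
  qed
  have prod: "real (nat \<bar>x\<bar>) = (\<Prod>p\<in>F. real p ^ multiplicity (int p) x)"
    if "x \<noteq> 0" "x = a \<or> x = b" for x
  proof -
    have "nat \<bar>x\<bar> = (\<Prod>p\<in>prime_factors (nat \<bar>x\<bar>). p ^ multiplicity p (nat \<bar>x\<bar>))"
      using prime_factorization_nat[of "nat \<bar>x\<bar>"] that by simp
    also have "\<dots> = (\<Prod>p\<in>F. p ^ multiplicity p (nat \<bar>x\<bar>))"
    proof (rule prod.mono_neutral_left)
      show "prime_factors (nat \<bar>x\<bar>) \<subseteq> F"
        using mem that by (auto simp: in_prime_factors_iff)
      show "\<forall>p\<in>F - prime_factors (nat \<bar>x\<bar>). p ^ multiplicity p (nat \<bar>x\<bar>) = 1"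
        using F that by (auto simp: in_prime_factors_iff not_dvd_imp_multiplicity_0)
    qed (use F in simp)
    finally show ?thesis
      unfolding mult by (metis (no_types, lifting) of_nat_power of_nat_prod prod.cong)
  qed
  have "of_rat \<bar>r\<bar> = real (nat \<bar>a\<bar>) / real (nat \<bar>b\<bar>)"
    using ab by (simp add: of_rat_divide abs_divide flip: of_int_abs)
  also have "\<dots> = (\<Prod>p\<in>F. real p ^ multiplicity (int p) a / real p ^ multiplicity (int p) b)"
    using prod[of a] prod[of b] nz by (simp add: prod_dividef)
  also have "\<dots> = (\<Prod>p\<in>F. inverse (padic_abs_rat p r))"
  proof (rule prod.cong)
    fix p
    assume "p \<in> F"
    then have p: "prime p"
      by (rule F)
    then show "real p ^ multiplicity (int p) a / real p ^ multiplicity (int p) b =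
        inverse (padic_abs_rat p r)"
      using r prime_gt_0_nat[OF p]
      by (simp add: padic_abs_rat_def ord power_int_diff power_int_minus)
  qed simp
  finally show ?thesis .
qed


section \<open>Bernoulli numbers\<close>

text \<open>The defining quotient is exact because exp X - 1 has subdegree 1, just like X.\<close>

lemma bernoulli_fps_times:
  "Abs_fps (\<lambda>n. bernoulli n / fact n) * (fps_exp 1 - 1) = fps_X"
proof -
  have sub: "subdegree (fps_exp 1 - 1 :: rat fps) = 1"
    by (rule subdegreeI) auto
  have "(fps_exp 1 - 1 :: rat fps) dvd fps_X"
    by (subst fps_dvd_iff) (use sub in auto)
  then have "fps_X / (fps_exp 1 - 1) * (fps_exp 1 - 1 :: rat fps) = fps_X"
    by (rule dvd_div_mult_self)
  moreover have "Abs_fps (\<lambda>n. bernoulli n / fact n) = fps_X / (fps_exp 1 - 1)"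
    by (simp add: fps_eq_iff bernoulli_def)
  ultimately show ?thesis
    by simp
qed

text \<open>Faulhaber's formula. The series exp(j X) for j < N form a geometric sum S with S (exp X
  - 1) = exp(N X) - 1; multiplication by B = X / (exp X - 1) gives S X = B (exp(N X) - 1), and the
  coefficients of X^(m+1) are compared.\<close>

lemma sum_powers_bernoulli:
  "(\<Sum>j<N. of_nat j ^ m) =
    (\<Sum>i\<le>m. fact m / (fact i * fact (Suc m - i)) * bernoulli i * of_nat N ^ (Suc m - i))"
proof -
  define B where "B = Abs_fps (\<lambda>n. bernoulli n / fact n)"
  define S where "S = (\<Sum>j<N. fps_exp (of_nat j :: rat))"
  have S: "S * (fps_exp 1 - 1) = fps_exp (of_nat N) - 1"
    unfolding S_def
  proof (induction N)
    case (Suc N)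
    have "fps_exp (of_nat (Suc N)) = fps_exp (of_nat N) * fps_exp (1 :: rat)"
      by (simp add: add.commute flip: fps_exp_add_mult)
    with Suc show ?case
      by (simp add: algebra_simps)
  qed simp
  have "S * fps_X = B * (S * (fps_exp 1 - 1))"
    using bernoulli_fps_times by (simp add: B_def mult.left_commute)
  also have "\<dots> = B * (fps_exp (of_nat N) - 1)"
    by (simp only: S)
  finally have "(S * fps_X) $ Suc m = (B * (fps_exp (of_nat N) - 1)) $ Suc m"
    by simp
  also have "\<dots> = (\<Sum>i\<le>Suc m. bernoulli i / fact i * (fps_exp (of_nat N) - 1) $ (Suc m - i))"
    by (simp add: fps_mult_nth B_def atMost_atLeast0)
  \<comment> \<open>The term i = m + 1 drops out since exp(N X) - 1 has no constant term.\<close>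
  also have "\<dots> = (\<Sum>i\<le>m. bernoulli i / fact i * (of_nat N ^ (Suc m - i) / fact (Suc m - i)))"
    by (simp add: mult.commute)
  finally have "(\<Sum>j<N. of_nat j ^ m / fact m) =
      (\<Sum>i\<le>m. bernoulli i / fact i * (of_nat N ^ (Suc m - i) / fact (Suc m - i)))"
    by (simp add: S_def fps_sum_nth)
  then have "(\<Sum>j<N. of_nat j ^ m) / fact m =
      (\<Sum>i\<le>m. bernoulli i / fact i * (of_nat N ^ (Suc m - i) / fact (Suc m - i)))"
    by (simp add: sum_divide_distrib)
  then have "(\<Sum>j<N. of_nat j ^ m) =
      fact m * (\<Sum>i\<le>m. bernoulli i / fact i * (of_nat N ^ (Suc m - i) / fact (Suc m - i)))"
    by (simp add: field_simps)
  then show ?thesis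
    by (simp add: sum_distrib_left mult_ac)
qed

section \<open>Power sums as p-adic approximations of Bernoulli numbers\<close>

lemma common_denominator:
  fixes c :: "'a \<Rightarrow> rat"
  assumes "finite A"
  obtains d :: int where "d \<noteq> 0" "\<And>i. i \<in> A \<Longrightarrow> of_int d * c i \<in> \<int>"
proof -
  define d where "d = (\<Prod>i\<in>A. snd (quotient_of (c i)))"
  have "d \<noteq> 0"
    using assms quotient_of_denom_pos' by (auto simp: d_def less_imp_neq[THEN not_sym])
  moreover have "of_int d * c i \<in> \<int>" if "i \<in> A" for i
  proof -
    obtain a b where ab: "quotient_of (c i) = (a, b)"
      by force
    then have c: "c i = of_int a / of_int b" "b > 0"
      using quotient_of_div quotient_of_denom_pos by blast+
    have "b dvd d"
      unfolding d_def using assms that ab by (intro dvd_trans[OF _ dvd_prodI[of A i]]) auto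
    then obtain e where "d = b * e" ..
    then have "of_int d * c i = of_int (e * a)"
      using c by simp
    then show ?thesis
      by (metis Ints_of_int)
  qed
  ultimately show thesis
    using that by blast
qed

text \<open>In Faulhaber's formula the index i = m contributes B_m N, and each smaller index a
  rational constant times a power of N with exponent at least 2. The denominators of these constants
  are cleared by a \<open>d\<close> depending on m alone; this uniformity in N makes the estimate a
  p-adic limit along N = p^k.\<close>

lemma sum_powers_approx_bernoulli:
  obtains d :: int where "d \<noteq> 0"
    "\<And>N. N > 0 \<Longrightarrow> \<exists>z::int.
       of_int d * ((\<Sum>j<N. of_nat j ^ m) / of_nat N - bernoulli m) = of_nat N * of_int z"
proof -
  define c where "c i = fact m / (fact i * fact (Suc m - i)) * bernoulli i" for i
  obtain d :: int where d: "d \<noteq> 0" "\<And>i. i \<in> {..<m} \<Longrightarrow> of_int d * c i \<in> \<int>"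
    using common_denominator[of "{..<m}" c] by blast
  have "\<exists>z::int. of_int d * ((\<Sum>j<N. of_nat j ^ m) / of_nat N - bernoulli m) = of_nat N * of_int z"
    if N: "N > 0" for N
  proof -
    have "(\<Sum>j<N. of_nat j ^ m :: rat) = (\<Sum>i<m. c i * of_nat N ^ (Suc m - i)) + bernoulli m * of_nat N"
      by (simp add: sum_powers_bernoulli c_def flip: lessThan_Suc_atMost)
    also have "(\<Sum>i<m. c i * of_nat N ^ (Suc m - i)) =
        of_nat N * (of_nat N * (\<Sum>i<m. c i * of_nat N ^ (m - Suc i)))"
      unfolding sum_distrib_left
    proof (rule sum.cong)
      fix i
      assume "i \<in> {..<m}"
      then have "Suc m - i = Suc (Suc (m - Suc i))"
        by auto
      then show "c i * of_nat N ^ (Suc m - i) = of_nat N * (of_nat N * (c i * of_nat N ^ (m - Suc i)))"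
        by simp
    qed simp
    finally have eq: "(\<Sum>j<N. of_nat j ^ m) / of_nat N - bernoulli m =
        of_nat N * (\<Sum>i<m. c i * of_nat N ^ (m - Suc i))"
      using N by (simp add: add_divide_distrib)
    have "(\<Sum>i<m. (of_int d * c i) * of_nat N ^ (m - Suc i)) \<in> \<int>"
      using d(2) by (intro Ints_sum Ints_mult[of "of_int d * _"] Ints_power) auto
    then obtain z where "(\<Sum>i<m. (of_int d * c i) * of_nat N ^ (m - Suc i)) = (of_int z :: rat)"
      by (rule Ints_cases)
    then have "of_int d * (\<Sum>i<m. c i * of_nat N ^ (m - Suc i)) = of_int z"
      by (simp add: sum_distrib_left mult.assoc)
    then have "of_int d * ((\<Sum>j<N. of_nat j ^ m) / of_nat N - bernoulli m) = of_nat N * of_int z"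
      unfolding eq by (simp add: mult.left_commute)
    then show ?thesis ..
  qed
  with d(1) show thesis
    using that by blast
qed

text \<open>
  The even part \<open>f\<close> of \<open>X / (exp X - 1)\<close> satisfies \<open>X f' = f - f\<^sup>2 + X\<^sup>2 / 4\<close>; comparing
  coefficients expresses each coefficient as a sum of products of earlier ones, all of the same sign.
\<close>

lemma bernoulli_sign:
  assumes "even n" "n > 0"
  shows "(-1) ^ (n div 2 - 1) * bernoulli n > 0"
proof -
  define E where "E = (fps_exp 1 :: rat fps)"
  define B where "B = Abs_fps (\<lambda>n. bernoulli n / fact n)"
  define f where "f = B + fps_const (1/2) * fps_X"
  have BE: "B * (E - 1) = fps_X"
    using bernoulli_fps_times by (simp add: B_def E_def)
  \<comment> \<open>Differentiating B (E - 1) = X with E' = E leaves no derivative of E; multiplying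
    by B and substituting B (E - 1) = X once more removes E itself.\<close>
  have "fps_deriv (B * (E - 1)) = 1"
    by (simp add: BE)
  then have D: "fps_deriv B * (E - 1) + B * E = 1"
    by (simp add: E_def add.commute)
  have "fps_X * fps_deriv B = B * (E - 1) * fps_deriv B"
    by (simp add: BE)
  also have "\<dots> = B * (fps_deriv B * (E - 1))"
    by (simp only: mult_ac)
  also have "fps_deriv B * (E - 1) = 1 - B * E"
    using D by (rule eq_diff_eq[THEN iffD2])
  also have "B * (1 - B * E) = B - B * (B * (E - 1)) - B * B"
    by (simp add: algebra_simps)
  finally have ode: "fps_X * fps_deriv B = B - B * fps_X - B * B"
    by (simp only: BE)
  define h where "h = fps_const (1/2 :: rat)"
  have h: "h + h = 1"
    by (simp add: h_def fps_eq_iff)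
  have "fps_X * fps_deriv f = f - f * f + (h * h) * fps_X * fps_X"
  proof -
    have "fps_X * fps_deriv f = fps_X * fps_deriv B + h * fps_X"
      by (simp add: f_def h_def algebra_simps)
    moreover have "f - f * f + (h * h) * fps_X * fps_X = B - (h + h) * B * fps_X - B * B + h * fps_X"
      by (simp add: f_def h_def[symmetric] algebra_simps)
    ultimately show ?thesis
      by (simp add: ode h)
  qed
  then have coeff: "(fps_X * fps_deriv f) $ k = (f - f * f + (h * h) * fps_X * fps_X) $ k" for k
    by simp
  have f0: "f $ 0 = 1"
  proof -
    have "(B * (E - 1)) $ 1 = 1"
      by (simp add: BE)
    then show ?thesis
      by (simp add: fps_mult_nth E_def f_def)
  qed
  \<comment> \<open>As f_0 = 1, the two outer terms of the convolution give 2 f_k; k f_k on one side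
    and f_k - 2 f_k on the other combine to (k + 1) f_k.\<close>
  have rec: "of_nat (k + 1) * f $ k = (if k = 2 then 1/4 else 0) - (\<Sum>i=1..<k. f $ i * f $ (k - i))"
    if "k > 0" for k
  proof -
    have "(f * f) $ k = (\<Sum>i=0..k. f $ i * f $ (k - i))"
      by (rule fps_mult_nth)
    also have "{0..k} = insert 0 (insert k {1..<k})"
      using that by auto
    finally have ff: "(f * f) $ k = 2 * f $ k + (\<Sum>i=1..<k. f $ i * f $ (k - i))"
      using that by (simp add: f0)
    have "((h * h) * fps_X * fps_X) $ k = (if k = 2 then 1/4 else 0)"
      using that by (auto simp: h_def mult.assoc simp flip: power2_eq_square) (simp add: power2_eq_square)
    moreover have "(fps_X * fps_deriv f) $ k = of_nat k * f $ k"
      using that by simp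
    ultimately show ?thesis
      using coeff[of k] ff by (simp add: algebra_simps)
  qed
  \<comment> \<open>Vanishing at odd indices is part of the induction, so that only products of
    even-indexed coefficients survive in the convolution.\<close>
  have "if even k then (-1) ^ (k div 2 - 1) * f $ k > 0 else f $ k = 0" if "k > 0" for k
    using that
  proof (induction k rule: less_induct)
    case (less k)
    show ?case
    proof (cases "even k")
      case False
      have "(\<Sum>i=1..<k. f $ i * f $ (k - i)) = 0"
      proof (rule sum.neutral, rule ballI)
        fix i
        assume i: "i \<in> {1..<k}"
        have "odd i \<or> odd (k - i)"
          using False i by auto
        then show "f $ i * f $ (k - i) = 0"
          using less.IH[of i] less.IH[of "k - i"] i by (cases "even i"; cases "even (k - i)") auto
      qed
      then have "of_nat (k + 1) * f $ k = 0"
        using rec[OF less.prems] False by auto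
      with False show ?thesis
        by (simp del: of_nat_Suc of_nat_add)
    next
      case True
      then obtain q where k: "k = 2 * q" ..
      have "(-1) ^ (q - 1) * (of_nat (k + 1) * f $ k) > 0"
      proof (cases "q = 1")
        \<comment> \<open>The term X^2 / 4 acts only at k = 2: there 3 f_2 = 1/4, which starts the
          alternation of signs.\<close>
        case True
        have "f $ Suc 0 = 0"
          using rec[of 1] by simp
        then show ?thesis
          using rec[of 2] True k by (simp add: numeral_2_eq_2)
      next
        case False
        with k less.prems have q: "q \<ge> 2"
          by simp
        \<comment> \<open>For i = 2 j the signs of f_i and f_(k-i) multiply to (-1)^((j-1) +
          (q-j-1)) = (-1)^q, independently of j; this common sign is factored out.\<close>
        define g where "g i = (-1) ^ q * (f $ i * f $ (k - i))" for i
        have pos: "g i > 0" if i: "i \<in> {1..<k}" "even i" for i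
        proof -
          obtain j where j: "i = 2 * j"
            using i by blast
          have "(-1) ^ (j - 1) * f $ i > 0" "(-1) ^ (q - j - 1) * f $ (k - i) > 0"
            using less.IH[of i] less.IH[of "k - i"] i k j by (simp_all flip: diff_mult_distrib2)
          then have "((-1) ^ (j - 1) * f $ i) * ((-1) ^ (q - j - 1) * f $ (k - i)) > 0"
            by (rule mult_pos_pos)
          also have "((-1) ^ (j - 1) * f $ i) * ((-1) ^ (q - j - 1) * f $ (k - i)) =
              (-1) ^ ((j - 1) + (q - j - 1)) * (f $ i * f $ (k - i))"
            by (simp only: power_add mult_ac)
          also have "(-1 :: rat) ^ ((j - 1) + (q - j - 1)) = (-1) ^ q"
          proof -
            have "q = (j - 1) + (q - j - 1) + 2"
              using i j k by auto
            then show ?thesis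
              by (metis power_add power_one_right mult_1_right power2_minus power_one power2_eq_1_iff)
          qed
          finally show ?thesis
            by (simp add: g_def)
        qed
        have "0 < sum g {1..<k}"
        proof (rule sum_pos2)
          show "2 \<in> {1..<k}" "0 < g 2"
            using pos[of 2] q k by auto
          show "0 \<le> g i" if "i \<in> {1..<k}" for i
          proof (cases "even i")
            case False
            then show ?thesis
              using less.IH[of i] that by (simp add: g_def)
          qed (use pos that in force)
        qed simp
        moreover have "sum g {1..<k} = (-1) ^ q * (\<Sum>i=1..<k. f $ i * f $ (k - i))"
          by (simp add: g_def sum_distrib_left)
        moreover have "(-1 :: rat) ^ q = - ((-1) ^ (q - 1))"
          using q by (cases q) auto
        moreover have "of_nat (k + 1) * f $ k = - (\<Sum>i=1..<k. f $ i * f $ (k - i))"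
          using rec[of k] less.prems k q by auto
        ultimately show ?thesis
          by (simp only: mult_minus_left mult_minus_right)
      qed
      then have "of_nat (k + 1) * ((-1) ^ (q - 1) * f $ k) > 0"
        by (simp only: mult.left_commute)
      then show ?thesis
        using True k by (simp add: zero_less_mult_iff del: of_nat_Suc of_nat_add)
    qed
  qed
  from this[of n] have "(-1) ^ (n div 2 - 1) * f $ n > 0"
    using assms by simp
  moreover have "f $ n = bernoulli n / fact n"
    using assms by (auto simp: f_def B_def)
  ultimately show ?thesis
    by (simp add: zero_less_divide_iff)
qed


section \<open>Kummer's congruences\<close>

text \<open>The binomial expansion to first order. It is applied with y a multiple of N or of p^k,
  so that y^2 is negligible.\<close>

lemma power_diff_cong_linear:
  fixes x y :: "'a :: comm_ring_1"
  shows "y ^ 2 dvd (x - y) ^ Suc k - x ^ Suc k + of_nat (Suc k) * y * x ^ k"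
proof (induction k)
  case (Suc k)
  then obtain c where c: "(x - y) ^ Suc k - x ^ Suc k + of_nat (Suc k) * y * x ^ k = y ^ 2 * c" ..
  have "(x - y) ^ Suc (Suc k) = (x - y) * (x ^ Suc k - of_nat (Suc k) * y * x ^ k + y ^ 2 * c)"
    by (simp flip: c)
  then have "(x - y) ^ Suc (Suc k) - x ^ Suc (Suc k) + of_nat (Suc (Suc k)) * y * x ^ Suc k =
      y ^ 2 * (of_nat (Suc k) * x ^ k + c * (x - y))"
    by (simp add: algebra_simps power2_eq_square)
  then show ?case
    by simp
qed simp

section \<open>Voronoi's congruence\<close>

definition voronoi_sum :: "nat \<Rightarrow> nat \<Rightarrow> nat \<Rightarrow> int" where
  "voronoi_sum a k N = (\<Sum>j<N. int ((j * a) ^ k * (j * a div N)))"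

lemma bij_betw_mult_mod:
  fixes a N :: nat
  assumes "coprime a N" "N > 0"
  shows "bij_betw (\<lambda>j. j * a mod N) {..<N} {..<N}"
proof -
  have "inj_on (\<lambda>j. j * a mod N) {..<N}"
  proof (rule inj_onI)
    fix i j
    assume ij: "i \<in> {..<N}" "j \<in> {..<N}" "i * a mod N = j * a mod N"
    then have "[i * a = j * a] (mod N)"
      by (simp add: cong_def)
    then have "[i = j] (mod N)"
      using assms cong_mult_rcancel_nat by blast
    with ij show "i = j"
      by (simp add: cong_def)
  qed
  moreover have "(\<lambda>j. j * a mod N) ` {..<N} \<subseteq> {..<N}"
    using assms by auto
  ultimately show ?thesis
    by (simp add: bij_betw_def endo_inj_surj)
qed

text \<open>For m = k + 1, expand (j a mod N)^m = (j a - N q)^m with q = floor(j a / N) to first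
  order and sum over j. As j a mod N runs through all residues, the left-hand sides add up to the
  power sum again.\<close>

lemma voronoi_congruence:
  assumes "coprime a N" "N > 0"
  shows "int N ^ 2 dvd (int a ^ Suc k - 1) * (\<Sum>j<N. int j ^ Suc k) - int (Suc k) * int N * voronoi_sum a k N"
proof -
  have "int N ^ 2 dvd int (j * a mod N) ^ Suc k - int (j * a) ^ Suc k +
      int (Suc k) * int N * int ((j * a) ^ k * (j * a div N))" for j
  proof -
    define q where "q = int (j * a div N)"
    have "int (j * a mod N) = int (j * a) - int N * q"
      by (simp add: q_def zmod_int zdiv_int minus_mult_div_eq_mod)
    moreover have "(int N * q) ^ 2 dvd (int (j * a) - int N * q) ^ Suc k - int (j * a) ^ Suc k +
        of_nat (Suc k) * (int N * q) * int (j * a) ^ k"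
      by (rule power_diff_cong_linear)
    moreover have "int N ^ 2 dvd (int N * q) ^ 2"
      by (simp add: power_mult_distrib)
    ultimately show ?thesis
      by (auto simp: q_def mult_ac intro: dvd_trans)
  qed
  then have "int N ^ 2 dvd (\<Sum>j<N. int (j * a mod N) ^ Suc k - int (j * a) ^ Suc k +
      int (Suc k) * int N * int ((j * a) ^ k * (j * a div N)))"
    by (rule dvd_sum)
  also have "\<dots> = (\<Sum>j<N. int (j * a mod N) ^ Suc k) - int a ^ Suc k * (\<Sum>j<N. int j ^ Suc k) +
      int (Suc k) * int N * voronoi_sum a k N"
    by (simp add: sum.distrib sum_subtractf voronoi_sum_def power_mult_distrib sum_distrib_left
        sum_distrib_right mult_ac)
  also have "(\<Sum>j<N. int (j * a mod N) ^ Suc k) = (\<Sum>j<N. int j ^ Suc k)"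
    by (rule sum.reindex_bij_betw[OF bij_betw_mult_mod[OF assms]])
  finally have "int N ^ 2 dvd - ((\<Sum>j<N. int j ^ Suc k) - int a ^ Suc k * (\<Sum>j<N. int j ^ Suc k) +
      int (Suc k) * int N * voronoi_sum a k N)"
    by (simp only: dvd_minus_iff)
  also have "\<dots> = (int a ^ Suc k - 1) * (\<Sum>j<N. int j ^ Suc k) - int (Suc k) * int N * voronoi_sum a k N"
    by (simp add: algebra_simps del: power_Suc of_nat_Suc)
  finally show ?thesis .
qed

text \<open>Dividing the congruence modulo N^2 by N replaces the power sum by B_m up to a bounded
  denominator. The further division by m = k + 1 is paid for by enlarging the constant to d (k + 1),
  which is still independent of N.\<close>

lemma voronoi_approx:
  obtains d :: int where "d \<noteq> 0"
    "\<And>N. \<lbrakk>coprime a N; N > 0\<rbrakk> \<Longrightarrow> \<exists>z::int.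
       of_int d * ((of_nat a ^ Suc k - 1) * (bernoulli (Suc k) / of_nat (Suc k)) - of_int (voronoi_sum a k N))
         = of_nat N * of_int z"
proof -
  obtain d :: int where "d \<noteq> 0" and d: "\<And>N. N > 0 \<Longrightarrow> \<exists>z::int.
      of_int d * ((\<Sum>j<N. of_nat j ^ Suc k) / of_nat N - bernoulli (Suc k)) = of_nat N * of_int z"
    using sum_powers_approx_bernoulli[of "Suc k"] by blast
  have "\<exists>z::int. of_int (d * int (Suc k)) *
      ((of_nat a ^ Suc k - 1) * (bernoulli (Suc k) / of_nat (Suc k)) - of_int (voronoi_sum a k N))
        = of_nat N * of_int z" if N: "coprime a N" "N > 0" for N
  proof -
    define S :: rat where "S = (\<Sum>j<N. of_nat j ^ Suc k)"
    define A :: rat where "A = of_nat a ^ Suc k - 1"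
    define M :: rat where "M = of_nat (Suc k)"
    define V :: rat where "V = of_int (voronoi_sum a k N)"
    define B where "B = bernoulli (Suc k)"
    have nz: "M \<noteq> 0" "rat_of_nat N \<noteq> 0"
      using N(2) by (simp_all add: M_def del: of_nat_Suc)
    obtain z :: int where z: "of_int d * (S / of_nat N - B) = of_nat N * of_int z"
      using d[OF N(2)] by (auto simp: S_def B_def)
    obtain w where "(int a ^ Suc k - 1) * (\<Sum>j<N. int j ^ Suc k) - int (Suc k) * int N * voronoi_sum a k N
        = int N ^ 2 * w"
      using voronoi_congruence[OF N] by blast
    then have "(of_int ((int a ^ Suc k - 1) * (\<Sum>j<N. int j ^ Suc k) -
        int (Suc k) * int N * voronoi_sum a k N) :: rat) = of_int (int N ^ 2 * w)"
      by (simp only:)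
    then have "A * S - M * of_nat N * V = of_nat N ^ 2 * of_int w"
      by (simp add: A_def S_def M_def V_def)
    then have w: "A * (S / of_nat N) - M * V = of_nat N * of_int w"
      using nz by (simp add: field_simps power2_eq_square)
    have "of_int d * M * (A * (B / M) - V) =
        of_int d * (A * (S / of_nat N) - M * V) - A * (of_int d * (S / of_nat N - B))"
      using nz by (simp add: algebra_simps)
    also have "\<dots> = of_nat N * (of_int d * of_int w - A * of_int z)"
      unfolding w z by (simp add: algebra_simps)
    also have "of_int d * of_int w - A * of_int z = of_int (d * w - (int a ^ Suc k - 1) * z)"
      by (simp add: A_def)
    finally show ?thesis
      unfolding A_def B_def M_def V_def by (metis of_int_mult of_int_of_nat_eq)
  qed
  moreover have "d * int (Suc k) \<noteq> 0"
    using \<open>d \<noteq> 0\<close> by simp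
  ultimately show thesis
    using that by blast
qed

section \<open>Removal of the multiples of p\<close>

definition voronoi_sum_coprime :: "nat \<Rightarrow> nat \<Rightarrow> nat \<Rightarrow> nat \<Rightarrow> int" where
  "voronoi_sum_coprime p a k N = (\<Sum>j | j < N \<and> \<not> p dvd j. int ((j * a) ^ k * (j * a div N)))"

text \<open>For j = p i the floor of j a / (p N) equals that of i a / N, so the terms at multiples
  of p make up p^k times the sum belonging to N.\<close>

lemma voronoi_sum_split:
  assumes "p > 0"
  shows "voronoi_sum a k (p * N) = voronoi_sum_coprime p a k (p * N) + int p ^ k * voronoi_sum a k N"
proof -
  define f where "f j = int ((j * a) ^ k * (j * a div (p * N)))" for j
  have "{..<p * N} = {j. j < p * N \<and> \<not> p dvd j} \<union> (\<lambda>i. p * i) ` {..<N}"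
    using assms by (auto elim!: dvdE)
  moreover have "sum f ({j. j < p * N \<and> \<not> p dvd j} \<union> (\<lambda>i. p * i) ` {..<N}) =
      sum f {j. j < p * N \<and> \<not> p dvd j} + sum f ((\<lambda>i. p * i) ` {..<N})"
    by (rule sum.union_disjoint) auto
  moreover have "sum f ((\<lambda>i. p * i) ` {..<N}) = (\<Sum>i<N. f (p * i))"
    using assms by (subst sum.reindex) (auto simp: inj_on_def)
  moreover have "f (p * i) = int p ^ k * int ((i * a) ^ k * (i * a div N))" for i
  proof -
    have "p * i * a div (p * N) = i * a div N"
      using assms by (simp add: mult.assoc)
    then show ?thesis
      by (simp add: f_def power_mult_distrib mult_ac)
  qed
  ultimately show ?thesis
    by (simp add: voronoi_sum_def voronoi_sum_coprime_def f_def sum_distrib_left)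
qed

text \<open>Up to sign, the value of the \<open>p\<close>-adic zeta function interpolated at \<open>m\<close>.\<close>

definition bernoulli_euler :: "nat \<Rightarrow> nat \<Rightarrow> rat" where
  "bernoulli_euler p m = (1 - of_nat p ^ (m - 1)) * (bernoulli m / of_nat m)"

text \<open>Subtracting p^k times the approximation at p^r from the one at p^(r+1) leaves exactly
  the indices prime to p, and on the side of the limit the factor 1 - p^k, where k = m - 1.\<close>

lemma eventually_voronoi_sum_coprime:
  assumes p: "prime p" "coprime a p"
  shows "\<forall>\<^sub>F r in sequentially. ppow_dvd_rat p e
    ((of_nat a ^ Suc k - 1) * bernoulli_euler p (Suc k) - of_int (voronoi_sum_coprime p a k (p ^ Suc r)))"
proof -
  define b where "b = (of_nat a ^ Suc k - 1) * (bernoulli (Suc k) / of_nat (Suc k))"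
  define f where "f r = b - of_int (voronoi_sum a k (p ^ r))" for r
  obtain d :: int where "d \<noteq> 0" and d: "\<And>N. \<lbrakk>coprime a N; N > 0\<rbrakk> \<Longrightarrow> \<exists>z::int.
      of_int d * (b - of_int (voronoi_sum a k N)) = of_nat N * of_int z"
    unfolding b_def using voronoi_approx[of a k] by blast
  have "\<exists>z::int. of_int d * f r = of_nat p ^ r * of_int z" for r
    using d[of "p ^ r"] p prime_gt_0_nat[OF p(1)] by (simp add: f_def)
  then have ev: "\<forall>\<^sub>F r in sequentially. ppow_dvd_rat p e (f r)"
    by (intro eventually_ppow_dvd_rat[OF p(1) \<open>d \<noteq> 0\<close>])
  then have "\<forall>\<^sub>F r in sequentially. ppow_dvd_rat p e (f (Suc r))"
    by (rule eventually_sequentially_Suc[THEN iffD2])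
  with ev show ?thesis
  proof eventually_elim
    case (elim r)
    have "ppow_dvd_rat p 0 (of_int (int p ^ k))"
      using ppow_dvd_rat_of_int_iff[OF p(1)] by (metis power_0 one_dvd)
    with elim have "ppow_dvd_rat p e (f (Suc r) - of_int (int p ^ k) * f r)"
      using ppow_dvd_rat_mult[OF p(1), of 0 _ e] by (intro ppow_dvd_rat_diff[OF p(1)]) auto
    also have "f (Suc r) - of_int (int p ^ k) * f r =
        (1 - of_nat p ^ k) * b - of_int (voronoi_sum_coprime p a k (p ^ Suc r))"
      using voronoi_sum_split[of p a k "p ^ r"] prime_gt_0_nat[OF p(1)]
      by (simp add: f_def algebra_simps)
    also have "(1 - of_nat p ^ k) * b = (of_nat a ^ Suc k - 1) * bernoulli_euler p (Suc k)"
      by (simp add: b_def bernoulli_euler_def)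
    finally show ?case .
  qed
qed

text \<open>Every base j a is a unit modulo p^e, and the floor factor does not involve the exponent.
  With multiples of p among the indices, small exponents could be exceptions.\<close>

lemma voronoi_sum_coprime_cong:
  assumes p: "prime p" "coprime a p" and kl: "[k = l] (mod totient (p ^ e))"
  shows "int p ^ e dvd voronoi_sum_coprime p a k N - voronoi_sum_coprime p a l N"
proof -
  have "int p ^ e dvd int ((j * a) ^ k * c) - int ((j * a) ^ l * c)" if "\<not> p dvd j" for j c
  proof -
    have "coprime j p"
      using that p(1) prime_imp_coprime coprime_commute by blast
    then have cop: "coprime (p ^ e) (j * a)"
      using p(2) by (simp add: coprime_commute)
    have "[k = l] (mod ord (p ^ e) (j * a))"
      using kl order_divides_totient[OF cop] by (rule cong_dvd_modulus_nat)
    then have "[(j * a) ^ k = (j * a) ^ l] (mod p ^ e)"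
      by (simp only: order_divides_expdiff[OF cop])
    then have "[(j * a) ^ k * c = (j * a) ^ l * c] (mod p ^ e)"
      by (rule cong_scalar_right)
    then have "[int ((j * a) ^ k * c) = int ((j * a) ^ l * c)] (mod int (p ^ e))"
      by (simp only: cong_int_iff)
    then show ?thesis
      by (simp add: cong_iff_dvd_diff)
  qed
  then show ?thesis
    unfolding voronoi_sum_coprime_def sum_subtractf[symmetric] by (intro dvd_sum) auto
qed

text \<open>Supplies the multiplier for Voronoi's sums: for every m that p - 1 does not divide, a^m
  - 1 can be cancelled modulo powers of p.\<close>

lemma prime_primroot:
  assumes "prime p"
  obtains a where "coprime a p" "\<And>m. int p dvd int a ^ m - 1 \<longleftrightarrow> (p - 1) dvd m"
proof -
  obtain a where a: "a \<in> totatives p" "ord p a = p - 1"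
    using residue_prime_has_primroot[OF assms] by blast
  have "int p dvd int a ^ m - 1 \<longleftrightarrow> [a ^ m = 1] (mod p)" for m
    by (metis cong_iff_dvd_diff cong_int_iff of_nat_1 of_nat_power)
  then have "int p dvd int a ^ m - 1 \<longleftrightarrow> (p - 1) dvd m" for m
    by (simp only: ord_divides a(2))
  moreover have "coprime a p"
    using a by (simp add: totatives_def)
  ultimately show thesis
    using that by blast
qed

text \<open>Essentially Adams's theorem. The Voronoi sums are integers and a^m - 1 is a p-unit, so a
  single level r with p-integral error suffices.\<close>

lemma bernoulli_euler_integral:
  assumes p: "prime p" and m: "\<not> (p - 1) dvd m"
  shows "ppow_dvd_rat p 0 (bernoulli_euler p m)"
proof -
  obtain k where k: "m = Suc k"
    using m by (cases m) auto
  obtain a where a: "coprime a p" "\<And>m. int p dvd int a ^ m - 1 \<longleftrightarrow> (p - 1) dvd m"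
    using prime_primroot[OF p] by blast
  define A where "A = int a ^ m - 1"
  have A: "\<not> int p dvd A"
    using a(2) m by (simp add: A_def)
  obtain r where "ppow_dvd_rat p 0
      (of_int A * bernoulli_euler p m - of_int (voronoi_sum_coprime p a k (p ^ Suc r)))"
    using eventually_happens[OF eventually_voronoi_sum_coprime[OF p a(1), of 0 k]]
    by (auto simp: A_def k)
  then have "ppow_dvd_rat p 0 (of_int A * bernoulli_euler p m)"
    using ppow_dvd_rat_diff_iff[OF p] ppow_dvd_rat_of_int_iff[OF p] by (metis power_0 one_dvd)
  then show ?thesis
    by (simp only: ppow_dvd_rat_int_mult_iff[OF p A])
qed

theorem kummer_congruence:
  assumes p: "prime p" and m: "\<not> (p - 1) dvd m" "\<not> (p - 1) dvd n"
    and mn: "[m = n] (mod totient (p ^ e))"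
  shows "ppow_dvd_rat p e (bernoulli_euler p m - bernoulli_euler p n)"
proof -
  obtain k where k: "m = Suc k"
    using m by (cases m) auto
  obtain l where l: "n = Suc l"
    using m by (cases n) auto
  have kl: "[k = l] (mod totient (p ^ e))"
    using mn k l cong_add_rcancel_nat[of k 1 l] by simp
  obtain a where a: "coprime a p" "\<And>m. int p dvd int a ^ m - 1 \<longleftrightarrow> (p - 1) dvd m"
    using prime_primroot[OF p] by blast
  define A where "A = int a ^ m - 1"
  define C where "C = int a ^ m - int a ^ n"
  define V where "V k r = (of_int (voronoi_sum_coprime p a k (p ^ Suc r)) :: rat)" for k r
  have A: "\<not> int p dvd A"
    using a(2) m by (simp add: A_def)
  have "[int (a ^ m) = int (a ^ n)] (mod int (p ^ e))"
  proof -
    have cop: "coprime (p ^ e) a"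
      using a(1) by (simp add: coprime_commute)
    have "[m = n] (mod ord (p ^ e) a)"
      using mn order_divides_totient[OF cop] by (rule cong_dvd_modulus_nat)
    then show ?thesis
      by (simp only: order_divides_expdiff[OF cop] cong_int_iff)
  qed
  then have "ppow_dvd_rat p e (of_int C)"
    by (simp only: ppow_dvd_rat_of_int_iff[OF p]) (simp add: C_def cong_iff_dvd_diff)
  from ppow_dvd_rat_mult[OF p this bernoulli_euler_integral[OF p m(2)]]
  have C: "ppow_dvd_rat p e (of_int C * bernoulli_euler p n)"
    by simp
  have "\<forall>\<^sub>F r in sequentially.
      ppow_dvd_rat p e ((of_nat a ^ m - 1) * bernoulli_euler p m - V k r) \<and>
      ppow_dvd_rat p e ((of_nat a ^ n - 1) * bernoulli_euler p n - V l r)"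
    unfolding eventually_conj_iff V_def k l using eventually_voronoi_sum_coprime[OF p a(1)] by blast
  then obtain r where r:
    "ppow_dvd_rat p e ((of_nat a ^ m - 1) * bernoulli_euler p m - V k r)"
    "ppow_dvd_rat p e ((of_nat a ^ n - 1) * bernoulli_euler p n - V l r)"
    using eventually_happens'[OF sequentially_bot] by blast
  have V: "ppow_dvd_rat p e (V k r - V l r)"
    using voronoi_sum_coprime_cong[OF p a(1) kl]
    unfolding V_def of_int_diff[symmetric] by (simp only: ppow_dvd_rat_of_int_iff[OF p])
  \<comment> \<open>Replacing a^n - 1 by a^m - 1 costs C = a^m - a^n times a p-integral number, and
    p^e divides C by Euler's theorem. Both Voronoi sums are taken at the same r, which allows their
    comparison term by term.\<close>
  have "of_int A * (bernoulli_euler p m - bernoulli_euler p n) =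
      ((of_nat a ^ m - 1) * bernoulli_euler p m - V k r)
      - ((of_nat a ^ n - 1) * bernoulli_euler p n - V l r) + (V k r - V l r)
      - of_int C * bernoulli_euler p n"
    by (simp add: A_def C_def algebra_simps)
  moreover have "ppow_dvd_rat p e \<dots>"
    by (intro ppow_dvd_rat_diff[OF p] ppow_dvd_rat_add[OF p] r V C)
  ultimately have "ppow_dvd_rat p e (of_int A * (bernoulli_euler p m - bernoulli_euler p n))"
    by (simp only:)
  then show ?thesis
    by (simp only: ppow_dvd_rat_int_mult_iff[OF p A])
qed


section \<open>The von Staudt--Clausen theorem\<close>

lemma sum_lessThan_mult:
  fixes f :: "nat \<Rightarrow> 'a :: comm_monoid_add"
  shows "(\<Sum>j<m * N. f j) = (\<Sum>i<m. \<Sum>j<N. f (i * N + j))"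
proof -
  have "sum f {k..<k + N} = (\<Sum>j<N. f (k + j))" for k
    using sum.shift_bounds_nat_ivl[of f 0 k N] by (simp add: add.commute atLeast0LessThan)
  then show ?thesis
    by (simp flip: sum.nat_group)
qed

text \<open>Write the indices below p^(k+1) as i p^k + j and expand to first order. The linear terms
  add up to n p^k (0 + ... + (p - 1)) times an integer; as n is even, n p (p - 1) / 2 is a multiple
  of p, also for p = 2.\<close>

lemma sum_powers_prime_power_step:
  assumes n: "even n" "n > 0" and k: "k > 0"
  shows "int p ^ Suc k dvd (\<Sum>j<p ^ Suc k. int j ^ n) - int p * (\<Sum>j<p ^ k. int j ^ n)"
proof -
  define P where "P = int p ^ k"
  obtain m where m: "n = Suc m"
    using n by (cases n) auto
  \<comment> \<open>This is where k > 0 enters: 2 k \<ge> k + 1.\<close>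
  have sq: "int p ^ Suc k dvd P ^ 2"
    unfolding P_def power_mult[symmetric] by (rule le_imp_power_dvd) (use k in auto)
  have "int p ^ Suc k dvd int n * P * (\<Sum>i<p. int i)"
  proof -
    obtain h where h: "n = 2 * h"
      using n by blast
    have "2 * (\<Sum>i<p. int i) = int p * (int p - 1)"
      by (induction p) (simp_all add: algebra_simps)
    then have "int n * P * (\<Sum>i<p. int i) = int p ^ Suc k * (int h * (int p - 1))"
      by (simp add: h P_def)
    then show ?thesis
      by simp
  qed
  then have "int p ^ Suc k dvd (\<Sum>j<p ^ k. int n * P * (\<Sum>i<p. int i) * int j ^ m)"
    by (intro dvd_sum) auto
  also have "\<dots> = (\<Sum>i<p. \<Sum>j<p ^ k. int n * (int i * P) * int j ^ m)"
    by (subst sum.swap) (simp add: sum_distrib_left sum_distrib_right mult_ac)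
  finally have lin: "int p ^ Suc k dvd (\<Sum>i<p. \<Sum>j<p ^ k. int n * (int i * P) * int j ^ m)" .
  have "int p ^ Suc k dvd (int (i * p ^ k + j)) ^ n - int j ^ n - int n * (int i * P) * int j ^ m" for i j
  proof -
    have "P ^ 2 dvd (- (int i * P)) ^ 2"
      by (simp add: power_mult_distrib)
    also have "(- (int i * P)) ^ 2 dvd (int j - (- (int i * P))) ^ Suc m - int j ^ Suc m +
        of_nat (Suc m) * (- (int i * P)) * int j ^ m"
      by (rule power_diff_cong_linear)
    finally have "P ^ 2 dvd (int j - (- (int i * P))) ^ Suc m - int j ^ Suc m +
        of_nat (Suc m) * (- (int i * P)) * int j ^ m" .
    moreover have "int j - (- (int i * P)) = int (i * p ^ k + j)"
      by (simp add: P_def)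
    ultimately have "P ^ 2 dvd int (i * p ^ k + j) ^ n - int j ^ n - int n * (int i * P) * int j ^ m"
      by (simp add: m algebra_simps del: power_Suc of_nat_Suc of_nat_add of_nat_mult of_nat_power)
    with sq show ?thesis
      by (rule dvd_trans)
  qed
  then have "int p ^ Suc k dvd (\<Sum>i<p. \<Sum>j<p ^ k.
      int (i * p ^ k + j) ^ n - int j ^ n - int n * (int i * P) * int j ^ m)"
    by (intro dvd_sum)
  from dvd_add[OF this lin] show ?thesis
    by (simp add: sum_subtractf sum_lessThan_mult)
qed

text \<open>By Fermat each of the p - 1 terms with j > 0 is 1 modulo p; the term j = 0 vanishes
  because n > 0.\<close>

lemma sum_powers_prime:
  assumes p: "prime p" "(p - 1) dvd n" and n: "n > 0"
  shows "int p dvd (\<Sum>j<p. int j ^ n) + 1"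
proof -
  have "int p dvd int j ^ n - 1" if j: "j \<in> {1..<p}" for j
  proof -
    have "\<not> p dvd j"
      using j by (auto dest: dvd_imp_le)
    then have "[j ^ (p - 1) = 1] (mod p)"
      using fermat_theorem p(1) by blast
    then have "[j ^ n = 1] (mod p)"
      using p(2) by (metis cong_pow dvdE power_mult power_one)
    then show ?thesis
      by (metis cong_iff_dvd_diff cong_int_iff of_nat_1 of_nat_power)
  qed
  then have "int p dvd (\<Sum>j=1..<p. int j ^ n - 1)"
    by (intro dvd_sum)
  then have "int p dvd (\<Sum>j=1..<p. int j ^ n - 1) + int p"
    by simp
  also have "(\<Sum>j=1..<p. int j ^ n - 1) + int p = (\<Sum>j=1..<p. int j ^ n) + 1"
    using prime_gt_0_nat[OF p(1)] by (simp add: sum_subtractf of_nat_diff)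
  also have "(\<Sum>j=1..<p. int j ^ n) = (\<Sum>j<p. int j ^ n)"
    by (rule sum.mono_neutral_left) (use n in auto)
  finally show ?thesis .
qed

text \<open>Passing to the next power of p multiplies the power sum by p up to a negligible error,
  so the residue -1 at k = 0 becomes -p^k.\<close>

lemma sum_powers_prime_power:
  assumes p: "prime p" "(p - 1) dvd n" and n: "even n" "n > 0"
  shows "int p ^ Suc k dvd (\<Sum>j<p ^ Suc k. int j ^ n) + int p ^ k"
proof (induction k)
  case 0
  then show ?case
    using sum_powers_prime[OF p n(2)] by simp
next
  case (Suc k)
  have "int p ^ Suc (Suc k) dvd int p * ((\<Sum>j<p ^ Suc k. int j ^ n) + int p ^ k)"
    using mult_dvd_mono[OF dvd_refl Suc, of "int p"] by (simp only: power_Suc[of "int p" "Suc k"])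
  from dvd_add[OF sum_powers_prime_power_step[OF n, of "Suc k" p] this] show ?case
    by (simp add: distrib_left)
qed

theorem von_staudt_clausen:
  assumes p: "prime p" "(p - 1) dvd n" and n: "even n" "n > 0"
  shows "padic_ord_rat p (bernoulli n) = - 1"
proof -
  define f where "f k = (\<Sum>j<p ^ k. of_nat j ^ n) / of_nat p ^ k - bernoulli n" for k
  obtain d :: int where "d \<noteq> 0" and d: "\<And>N. N > 0 \<Longrightarrow> \<exists>z::int.
      of_int d * ((\<Sum>j<N. of_nat j ^ n) / of_nat N - bernoulli n) = of_nat N * of_int z"
    using sum_powers_approx_bernoulli[of n] by blast
  have "\<exists>z::int. of_int d * f k = of_nat p ^ k * of_int z" for k
    using d[of "p ^ k"] prime_gt_0_nat[OF p(1)] by (simp add: f_def)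
  then have "\<forall>\<^sub>F k in sequentially. ppow_dvd_rat p 0 (f k)"
    by (intro eventually_ppow_dvd_rat[OF p(1) \<open>d \<noteq> 0\<close>])
  then obtain K where "\<And>k. k \<ge> K \<Longrightarrow> ppow_dvd_rat p 0 (f k)"
    by (auto simp: eventually_sequentially)
  \<comment> \<open>Integrality of one error is enough, since it is multiplied by p before residues
    modulo p are compared.\<close>
  then have f: "ppow_dvd_rat p 0 (f (Suc K))"
    by simp
  define b where "b = of_int (int p) * bernoulli n"
  have pp: "ppow_dvd_rat p 1 (of_int (int p))"
    by (subst ppow_dvd_rat_of_int_iff[OF p(1)]) simp
  obtain w where w: "(\<Sum>j<p ^ Suc K. int j ^ n) + int p ^ K = int p ^ Suc K * w"
    using sum_powers_prime_power[OF p n] by blast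
  have nz: "rat_of_nat p \<noteq> 0"
    using p(1) by auto
  have "(of_int ((\<Sum>j<p ^ Suc K. int j ^ n) + int p ^ K) :: rat) = of_int (int p ^ Suc K * w)"
    by (simp only: w)
  then have S: "(\<Sum>j<p ^ Suc K. of_nat j ^ n) = (of_nat p ^ Suc K * of_int w - of_nat p ^ K :: rat)"
    by (simp add: eq_diff_eq)
  \<comment> \<open>Divided by p^(K+1), the power sum is w - 1 / p: the source of the denominator p
    of B_n.\<close>
  have fK: "f (Suc K) = of_int w - 1 / of_nat p - bernoulli n"
    unfolding f_def S using nz by (simp add: diff_divide_distrib)
  have "b - of_int (- 1) = of_int (int p * w) - of_int (int p) * f (Suc K)"
    unfolding fK b_def using nz by (simp add: algebra_simps)
  also have "ppow_dvd_rat p 1 (of_int (int p * w) - of_int (int p) * f (Suc K))"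
    using ppow_dvd_rat_mult[OF p(1) pp f]
    by (intro ppow_dvd_rat_diff[OF p(1)]) (simp_all add: ppow_dvd_rat_of_int_iff[OF p(1)] del: of_int_mult of_int_of_nat_eq)
  finally have diff: "ppow_dvd_rat p 1 (b - of_int (- 1))" .
  have "\<not> ppow_dvd_rat p 1 (of_int (- 1))"
    using p(1) by (subst ppow_dvd_rat_of_int_iff) (auto dest: prime_gt_1_nat)
  then have not1: "\<not> ppow_dvd_rat p 1 b"
    using ppow_dvd_rat_diff_iff[OF p(1) diff] by simp
  have "ppow_dvd_rat p 0 (of_int (- 1))"
    by (subst ppow_dvd_rat_of_int_iff[OF p(1)]) simp
  then have b0: "ppow_dvd_rat p 0 b"
    using ppow_dvd_rat_diff_iff[OF p(1) ppow_dvd_rat_antimono[OF diff]] by blast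
  have nz': "bernoulli n \<noteq> 0"
    using not1 by (auto simp: b_def)
  have "b \<noteq> 0"
    using not1 by auto
  then have "padic_ord_rat p b = 0"
    using not1 b0 by (simp add: ppow_dvd_rat_def)
  moreover have "padic_ord_rat p b = 1 + padic_ord_rat p (bernoulli n)"
  proof -
    have "padic_ord_rat p (of_int (int p)) = 1"
      using prime_gt_1_nat[OF p(1)] multiplicity_self[of "int p"]
      by (subst padic_ord_rat_of_int[OF p(1)]) auto
    then show ?thesis
      unfolding b_def using nz nz' by (subst padic_ord_rat_mult[OF p(1)]) auto
  qed
  ultimately show "padic_ord_rat p (bernoulli n) = - 1"
    by simp
qed

text \<open>For m \<ge> 2 the Euler factor 1 - p^(m-1) is 1 modulo p and hence harmless for
  valuations; at m = 1 it would be 0.\<close>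

lemma bernoulli_euler_unit_factor:
  assumes "prime p" "m \<ge> 2"
  obtains c where "\<not> int p dvd c" "bernoulli_euler p m = of_int c * (bernoulli m / of_nat m)"
proof -
  have "int p dvd int p ^ (m - 1)"
    using assms by (intro dvd_power) auto
  then have "\<not> int p dvd 1 - int p ^ (m - 1)"
    using assms by (auto simp: dvd_diff_left_iff dest: prime_gt_1_nat)
  moreover have "bernoulli_euler p m = of_int (1 - int p ^ (m - 1)) * (bernoulli m / of_nat m)"
    by (simp add: bernoulli_euler_def)
  ultimately show thesis
    using that by blast
qed

lemma ppow_dvd_bernoulli_euler_iff:
  assumes "prime p" "m \<ge> 2"
  shows "ppow_dvd_rat p e (bernoulli_euler p m) \<longleftrightarrow> ppow_dvd_rat p e (bernoulli m / of_nat m)"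
  using bernoulli_euler_unit_factor[OF assms] ppow_dvd_rat_int_mult_iff[OF assms(1)] by metis

lemma padic_abs_bernoulli_euler:
  assumes "prime p" "m \<ge> 2"
  shows "padic_abs_rat p (bernoulli_euler p m) = padic_abs_rat p (bernoulli m / of_nat m)"
proof -
  obtain c where c: "\<not> int p dvd c" "bernoulli_euler p m = of_int c * (bernoulli m / of_nat m)"
    using bernoulli_euler_unit_factor[OF assms] .
  then have "c \<noteq> 0"
    by auto
  then have "padic_abs_rat p (of_int c) = 1"
    using c by (simp add: padic_abs_rat_def padic_ord_rat_of_int[OF assms(1)] not_dvd_imp_multiplicity_0)
  then show ?thesis
    unfolding c(2) padic_abs_rat_mult[OF assms(1)] by simp
qed

section \<open>The p-adic zeta function at natural numbers\<close>

lemma padic_of_rat_range: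
  assumes "p > 0"
  shows "0 \<le> padic_of_rat p r N" "padic_of_rat p r N < int p ^ N"
  using assms by (simp_all add: padic_of_rat_def)

text \<open>p-integrality makes the reduced denominator prime to p, so the modular inverse in the
  definition is a genuine one. Together with \<open>padic_of_rat_eqI\<close> this characterises the
  residues, and the inverse does not occur again.\<close>

lemma padic_of_rat_approx:
  assumes p: "prime p" and r: "ppow_dvd_rat p 0 r"
  shows "ppow_dvd_rat p N (r - of_int (padic_of_rat p r N))"
proof -
  obtain u v where uv: "quotient_of r = (u, v)"
    by force
  then have r_eq: "r = of_int u / of_int v" "v > 0" and cop: "coprime u v"
    using quotient_of_div quotient_of_denom_pos quotient_of_coprime by blast+
  obtain a b where ab: "\<not> int p dvd b" "r * of_int b = of_int a"
    using r ppow_dvd_rat_iff[OF p, of 0 r] by auto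
  have "\<not> int p dvd v"
  proof
    assume pv: "int p dvd v"
    have "(of_int (u * b) :: rat) = of_int (a * v)"
      using ab(2) r_eq by (simp add: field_simps)
    then have "u * b = a * v"
      by (simp only: of_int_eq_iff)
    then have "int p dvd u * b"
      using pv by simp
    then have "int p dvd u"
      using ab(1) p by (simp add: prime_dvd_mult_iff)
    then show False
      using coprime_common_divisor[OF cop _ pv] p by (auto dest: prime_gt_1_nat)
  qed
  then have copv: "coprime v (int p ^ N)"
    using p prime_imp_coprime[of "int p" v] by (simp add: coprime_commute)
  define w where "w = modular_inverse (int p ^ N) v"
  have "[v * w = 1] (mod int p ^ N)"
    unfolding w_def by (rule cong_modular_inverse1[OF copv])
  then have "[u * (v * w) = u * 1] (mod int p ^ N)"
    by (rule cong_scalar_left)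
  moreover have "[padic_of_rat p r N * v = u * w * v] (mod int p ^ N)"
    by (simp add: padic_of_rat_def uv w_def cong_def mod_mult_left_eq)
  ultimately have "[padic_of_rat p r N * v = u] (mod int p ^ N)"
    by (metis (no_types, lifting) cong_trans mult.assoc mult.commute mult.right_neutral)
  then have "int p ^ N dvd u - padic_of_rat p r N * v"
    by (simp add: cong_sym cong_iff_dvd_diff[symmetric])
  then obtain z where z: "u - padic_of_rat p r N * v = int p ^ N * z" ..
  have "(r - of_int (padic_of_rat p r N)) * of_int v = of_int (u - padic_of_rat p r N * v)"
    using r_eq by (simp add: algebra_simps)
  then have "(r - of_int (padic_of_rat p r N)) * of_int v = of_nat p ^ N * of_int z"
    unfolding z by simp
  then show ?thesis
    by (rule ppow_dvd_ratI[OF p \<open>\<not> int p dvd v\<close>])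
qed

lemma padic_of_rat_eqI:
  assumes p: "prime p" and r: "ppow_dvd_rat p 0 r"
    and w: "0 \<le> w" "w < int p ^ N" "ppow_dvd_rat p N (r - of_int w)"
  shows "padic_of_rat p r N = w"
proof -
  have "ppow_dvd_rat p N (r - of_int w - (r - of_int (padic_of_rat p r N)))"
    by (intro ppow_dvd_rat_diff[OF p] padic_of_rat_approx[OF p r] w)
  also have "r - of_int w - (r - of_int (padic_of_rat p r N)) = of_int (padic_of_rat p r N - w)"
    by simp
  finally have "int p ^ N dvd padic_of_rat p r N - w"
    by (simp only: ppow_dvd_rat_of_int_iff[OF p])
  then have "padic_of_rat p r N mod int p ^ N = w mod int p ^ N"
    by (simp only: mod_eq_dvd_iff)
  then show ?thesis
    using padic_of_rat_range[OF prime_gt_0_nat[OF p], of r N] w by simp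
qed

lemma padic_of_rat_carrier:
  assumes p: "prime p" and r: "ppow_dvd_rat p 0 r"
  shows "padic_of_rat p r \<in> carrier (Zp p)"
proof -
  have "padic_of_rat p r (Suc n) mod int p ^ n = padic_of_rat p r n" for n
  proof (rule padic_of_rat_eqI[OF p r, symmetric])
    let ?x = "padic_of_rat p r (Suc n)"
    have "ppow_dvd_rat p n (of_int (?x - ?x mod int p ^ n))"
      by (simp only: ppow_dvd_rat_of_int_iff[OF p] minus_mod_eq_mult_div dvd_triv_left)
    from ppow_dvd_rat_add[OF p ppow_dvd_rat_antimono[OF padic_of_rat_approx[OF p r, of "Suc n"]] this]
    show "ppow_dvd_rat p n (r - of_int (?x mod int p ^ n))"
      by simp
  qed (use prime_gt_0_nat[OF p] in simp_all)
  then show ?thesis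
    using padic_of_rat_range[OF prime_gt_0_nat[OF p], of r] by (simp add: Zp_simps)
qed

lemma padic_of_rat_eq_0_iff:
  assumes p: "prime p" and r: "ppow_dvd_rat p 0 r"
  shows "padic_of_rat p r N = 0 \<longleftrightarrow> ppow_dvd_rat p N r"
  using padic_of_rat_approx[OF p r, of N] padic_of_rat_eqI[OF p r, of 0 N] prime_gt_0_nat[OF p] by auto

lemma padic_of_rat_diff:
  assumes p: "prime p" and r: "ppow_dvd_rat p 0 r" and s: "ppow_dvd_rat p 0 s"
  shows "padic_of_rat p r \<ominus>\<^bsub>Zp p\<^esub> padic_of_rat p s = padic_of_rat p (r - s)"
proof -
  have "(padic_of_rat p r N - padic_of_rat p s N) mod int p ^ N = padic_of_rat p (r - s) N" for N
  proof (rule padic_of_rat_eqI[OF p ppow_dvd_rat_diff[OF p r s], symmetric])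
    let ?x = "padic_of_rat p r N - padic_of_rat p s N"
    have "ppow_dvd_rat p N (of_int (?x - ?x mod int p ^ N))"
      by (simp only: ppow_dvd_rat_of_int_iff[OF p] minus_mod_eq_mult_div dvd_triv_left)
    from ppow_dvd_rat_add[OF p ppow_dvd_rat_diff[OF p padic_of_rat_approx[OF p r, of N]
        padic_of_rat_approx[OF p s, of N]] this]
    show "ppow_dvd_rat p N (r - s - of_int (?x mod int p ^ N))"
      by (simp add: algebra_simps)
  qed (use prime_gt_0_nat[OF p] in simp_all)
  then show ?thesis
    using Zp_minus[OF prime_gt_0_nat[OF p] padic_of_rat_carrier[OF p r] padic_of_rat_carrier[OF p s]]
    by auto
qed

lemma padic_abs_of_rat:
  assumes p: "prime p" and r: "ppow_dvd_rat p 0 r"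
  shows "padic_abs p (padic_of_rat p r) = padic_abs_rat p r"
proof (cases "r = 0")
  case True
  then show ?thesis
    using padic_of_rat_eq_0_iff[OF p r] by (auto simp: padic_abs_def padic_abs_rat_def Zp_simps)
next
  case False
  with r have ord: "0 \<le> padic_ord_rat p r"
    by (simp add: ppow_dvd_rat_def)
  \<comment> \<open>The shift in \<open>padic_ord\<close> fits: the residue modulo p^(n+1) is
    nonzero exactly if the valuation is at most n.\<close>
  have iff: "padic_of_rat p r (Suc n) \<noteq> 0 \<longleftrightarrow> nat (padic_ord_rat p r) \<le> n" for n
    using padic_of_rat_eq_0_iff[OF p r, of "Suc n"] False by (auto simp: ppow_dvd_rat_def)
  from iff[of "nat (padic_ord_rat p r)"] have "padic_of_rat p r \<noteq> \<zero>\<^bsub>Zp p\<^esub>"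
    by (auto simp: Zp_simps)
  moreover have "padic_ord (padic_of_rat p r) = nat (padic_ord_rat p r)"
    unfolding padic_ord_def iff by (rule Least_equality) auto
  ultimately show ?thesis
    using False ord by (simp add: padic_abs_def padic_abs_rat_def)
qed

section \<open>Convergence of p-adic integers in terms of residues\<close>

text \<open>Compatibility passes a zero residue down to all smaller indices, so the zero residues of
  a nonzero y are exactly those up to index \<open>padic_ord y\<close>.\<close>

lemma Zp_residue_zero_iff_padic_abs_le:
  assumes p: "p > 1" and y: "y \<in> carrier (Zp p)"
  shows "y e = 0 \<longleftrightarrow> padic_abs p y \<le> inverse (real p ^ e)"
proof (cases "y = \<zero>\<^bsub>Zp p\<^esub>")
  case True
  with p show ?thesis
    by (simp add: padic_abs_def Zp_simps)
next
  case False
  have mod: "y (Suc n) mod int p ^ n = y n" for n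
    using y by (simp add: Zp_simps)
  have mono: "y i = 0" if "y j = 0" "i \<le> j" for i j
    using that(2,1)
  proof (induction rule: inc_induct)
    case (step n)
    then show ?case
      using mod[of n] by simp
  qed
  \<comment> \<open>The residue modulo p^0 = 1 is always 0, so a nonzero residue has an index of the
    form n + 1 and the minimum in \<open>padic_ord\<close> is attained.\<close>
  have "0 \<le> y 0 \<and> y 0 < int p ^ 0"
    using y by (simp only: Zp_simps)
  then have y0: "y 0 = 0"
    by simp
  from False obtain j where "y j \<noteq> 0"
    by (auto simp: Zp_simps)
  then obtain n where "y (Suc n) \<noteq> 0"
    using y0 by (cases j) auto
  then have "y (Suc (padic_ord y)) \<noteq> 0"
    unfolding padic_ord_def by (rule LeastI)
  moreover have "y i = 0" if "i \<le> padic_ord y" for i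
    using that not_less_Least[of "i - 1" "\<lambda>n. y (Suc n) \<noteq> 0"] y0
    by (cases i) (auto simp: padic_ord_def)
  ultimately have "y e = 0 \<longleftrightarrow> e \<le> padic_ord y"
    using mono[of e "Suc (padic_ord y)"] mono by (metis not_less_eq_eq)
  also have "\<dots> \<longleftrightarrow> real p ^ e \<le> real p ^ padic_ord y"
    using p by (simp add: power_increasing_iff)
  also have "\<dots> \<longleftrightarrow> padic_abs p y \<le> inverse (real p ^ e)"
    using p False by (simp add: padic_abs_def power_int_minus)
  finally show ?thesis .
qed

text \<open>Trades the real-valued limit for eventual equality of each residue, the form to which
  congruences of Bernoulli numbers apply directly.\<close>

lemma padic_tendsto_iff:
  assumes p: "p > 1" and X: "\<And>\<nu>. X \<nu> \<in> carrier (Zp p)" and x: "x \<in> carrier (Zp p)"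
  shows "padic_tendsto p X x \<longleftrightarrow> (\<forall>e. \<forall>\<^sub>F \<nu> in sequentially. X \<nu> e = x e)"
proof -
  interpret cring "Zp p"
    by (rule cring_Zp) (use p in simp)
  define a where "a = (\<lambda>\<nu>. padic_abs p (X \<nu> \<ominus>\<^bsub>Zp p\<^esub> x))"
  have "X \<nu> e = x e \<longleftrightarrow> (X \<nu> \<ominus>\<^bsub>Zp p\<^esub> x) e = 0" for \<nu> e
  proof -
    have "X \<nu> e mod int p ^ e = X \<nu> e" "x e mod int p ^ e = x e"
      using X[of \<nu>] x by (simp_all add: Zp_simps)
    then show ?thesis
      using Zp_minus[OF _ X[of \<nu>] x] p mod_eq_dvd_iff[of "X \<nu> e" "int p ^ e" "x e"]
      by (simp add: dvd_eq_mod_eq_0)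
  qed
  then have iff: "X \<nu> e = x e \<longleftrightarrow> a \<nu> \<le> inverse (real p ^ e)" for \<nu> e
    unfolding a_def using Zp_residue_zero_iff_padic_abs_le[OF p minus_closed[OF X x]] by blast
  have nonneg: "0 \<le> a \<nu>" for \<nu>
    by (simp add: a_def padic_abs_def)
  have "a \<longlonglongrightarrow> 0 \<longleftrightarrow> (\<forall>e. \<forall>\<^sub>F \<nu> in sequentially. a \<nu> \<le> inverse (real p ^ e))"
  proof
    assume lim: "a \<longlonglongrightarrow> 0"
    show "\<forall>e. \<forall>\<^sub>F \<nu> in sequentially. a \<nu> \<le> inverse (real p ^ e)"
    proof
      fix e
      have "\<forall>\<^sub>F \<nu> in sequentially. a \<nu> < inverse (real p ^ e)"
        using lim p by (intro order_tendstoD(2)[of a 0]) auto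
      then show "\<forall>\<^sub>F \<nu> in sequentially. a \<nu> \<le> inverse (real p ^ e)"
        by eventually_elim simp
    qed
  next
    assume *: "\<forall>e. \<forall>\<^sub>F \<nu> in sequentially. a \<nu> \<le> inverse (real p ^ e)"
    show "a \<longlonglongrightarrow> 0"
    proof (rule tendstoI)
      fix \<epsilon> :: real
      assume "\<epsilon> > 0"
      then obtain e where "inverse (real p) ^ e < \<epsilon>"
        using real_arch_pow_inv[of \<epsilon> "inverse (real p)"] p by (auto simp: inverse_less_1_iff)
      then have e: "inverse (real p ^ e) < \<epsilon>"
        by (simp add: power_inverse)
      from * have "\<forall>\<^sub>F \<nu> in sequentially. a \<nu> \<le> inverse (real p ^ e)"
        by blast
      then show "\<forall>\<^sub>F \<nu> in sequentially. dist (a \<nu>) 0 < \<epsilon>"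
        by eventually_elim (use nonneg e in auto)
    qed
  qed
  then show ?thesis
    unfolding padic_tendsto_def iff a_def .
qed

lemma padic_of_rat_tendsto_iff:
  assumes p: "prime p" and r: "\<And>\<nu>. ppow_dvd_rat p 0 (r \<nu>)" and s: "ppow_dvd_rat p 0 s"
  shows "padic_tendsto p (\<lambda>\<nu>. padic_of_rat p (r \<nu>)) (padic_of_rat p s) \<longleftrightarrow>
    (\<forall>e. \<forall>\<^sub>F \<nu> in sequentially. ppow_dvd_rat p e (r \<nu> - s))"
proof -
  have "padic_of_rat p (r \<nu>) e = padic_of_rat p s e \<longleftrightarrow> ppow_dvd_rat p e (r \<nu> - s)" for \<nu> e
  proof
    assume eq: "padic_of_rat p (r \<nu>) e = padic_of_rat p s e"
    have "ppow_dvd_rat p e (r \<nu> - of_int (padic_of_rat p (r \<nu>) e) - (s - of_int (padic_of_rat p s e)))"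
      by (intro ppow_dvd_rat_diff[OF p] padic_of_rat_approx[OF p] r s)
    then show "ppow_dvd_rat p e (r \<nu> - s)"
      by (simp add: eq)
  next
    assume "ppow_dvd_rat p e (r \<nu> - s)"
    from ppow_dvd_rat_add[OF p this padic_of_rat_approx[OF p s, of e]]
    show "padic_of_rat p (r \<nu>) e = padic_of_rat p s e"
      by (intro padic_of_rat_eqI[OF p r] padic_of_rat_range prime_gt_0_nat[OF p]) simp
  qed
  then show ?thesis
    using padic_tendsto_iff[OF prime_gt_1_nat[OF p] padic_of_rat_carrier[OF p r] padic_of_rat_carrier[OF p s]]
    by simp
qed

text \<open>Kummer's congruences make the limit in the definition of the zeta function exist at \<open>t\<close>.\<close>

lemma padic_zeta_of_nat:
  assumes p: "prime p" and l: "\<not> (p - 1) dvd l"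
  shows "padic_zeta p l (padic_of_rat p (of_nat t)) =
    padic_of_rat p (- bernoulli_euler p (l + (p - 1) * t))"
proof -
  define m where "m u = l + (p - 1) * u" for u
  have m: "\<not> (p - 1) dvd m u" for u
    using l by (simp add: m_def dvd_add_left_iff)
  have val: "ppow_dvd_rat p 0 (- bernoulli_euler p (m u))" for u
    using bernoulli_euler_integral[OF p m] p by simp
  have nat: "ppow_dvd_rat p 0 (of_nat u)" for u
    using ppow_dvd_rat_of_int_iff[OF p, of 0 "int u"] by simp
  have def: "padic_zeta p l s = (THE z. z \<in> carrier (Zp p) \<and>
     (\<forall>\<tau>::nat \<Rightarrow> nat. padic_tendsto p (\<lambda>\<nu>. padic_of_rat p (of_nat (\<tau> \<nu>))) s \<longrightarrow>
        padic_tendsto p (\<lambda>\<nu>. padic_of_rat p (- bernoulli_euler p (m (\<tau> \<nu>)))) z))" for s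
    by (simp add: padic_zeta_def m_def bernoulli_euler_def Let_def)
  show ?thesis
    unfolding def m_def[symmetric]
  proof (rule the_equality, intro conjI allI impI)
    show "padic_of_rat p (- bernoulli_euler p (m t)) \<in> carrier (Zp p)"
      by (rule padic_of_rat_carrier[OF p val])
  next
    fix \<tau> :: "nat \<Rightarrow> nat"
    assume "padic_tendsto p (\<lambda>\<nu>. padic_of_rat p (of_nat (\<tau> \<nu>))) (padic_of_rat p (of_nat t))"
    then have lim: "\<forall>\<^sub>F \<nu> in sequentially. ppow_dvd_rat p e (of_nat (\<tau> \<nu>) - of_nat t)" for e
      by (simp add: padic_of_rat_tendsto_iff[OF p nat nat])
    have "\<forall>\<^sub>F \<nu> in sequentially.
        ppow_dvd_rat p e (- bernoulli_euler p (m (\<tau> \<nu>)) - - bernoulli_euler p (m t))" for e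
      using lim[of e]
    proof eventually_elim
      case (elim \<nu>)
      then have "ppow_dvd_rat p e (of_int (int (\<tau> \<nu>) - int t))"
        by simp
      then have "[int (\<tau> \<nu>) = int t] (mod int (p ^ e))"
        by (simp only: ppow_dvd_rat_of_int_iff[OF p] cong_iff_dvd_diff of_nat_power)
      \<comment> \<open>Multiplication by p - 1 raises the modulus to (p - 1) p^e, a multiple of the
        totient of p^e also for e = 0.\<close>
      then have "[(p - 1) * \<tau> \<nu> = (p - 1) * t] (mod (p - 1) * p ^ e)"
        by (simp only: cong_int_iff) (simp add: cong_def mult_mod_right[symmetric])
      moreover have "totient (p ^ e) dvd (p - 1) * p ^ e"
      proof (cases e)
        case (Suc k)
        have "(p - 1) * p ^ Suc k = p ^ k * (p - 1) * p"
          by (simp only: power_Suc mult_ac)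
        then show ?thesis
          unfolding Suc totient_prime_power_Suc[OF p] by (rule dvdI)
      qed simp
      ultimately have "[m (\<tau> \<nu>) = m t] (mod totient (p ^ e))"
        unfolding m_def by (intro cong_add cong_refl) (rule cong_dvd_modulus_nat)
      from kummer_congruence[OF p m m this]
      have "ppow_dvd_rat p e (- (bernoulli_euler p (m (\<tau> \<nu>)) - bernoulli_euler p (m t)))"
        by (simp only: ppow_dvd_rat_minus_iff[OF p])
      then show ?case
        by simp
    qed
    then show "padic_tendsto p (\<lambda>\<nu>. padic_of_rat p (- bernoulli_euler p (m (\<tau> \<nu>))))
        (padic_of_rat p (- bernoulli_euler p (m t)))"
      by (simp only: padic_of_rat_tendsto_iff[OF p val val]) simp
  next
    fix z
    assume z: "z \<in> carrier (Zp p) \<and> (\<forall>\<tau>::nat \<Rightarrow> nat.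
      padic_tendsto p (\<lambda>\<nu>. padic_of_rat p (of_nat (\<tau> \<nu>))) (padic_of_rat p (of_nat t)) \<longrightarrow>
        padic_tendsto p (\<lambda>\<nu>. padic_of_rat p (- bernoulli_euler p (m (\<tau> \<nu>)))) z)"
    \<comment> \<open>Uniqueness: the constant sequence t is admissible, and its image is constant,
      which determines all residues of z.\<close>
    have "padic_tendsto p (\<lambda>\<nu>. padic_of_rat p (of_nat t)) (padic_of_rat p (of_nat t))"
      by (simp add: padic_of_rat_tendsto_iff[OF p nat nat])
    then have "padic_tendsto p (\<lambda>\<nu>. padic_of_rat p (- bernoulli_euler p (m t))) z"
      using z by (auto dest: spec[of _ "\<lambda>_. t"])
    then have "\<forall>e. padic_of_rat p (- bernoulli_euler p (m t)) e = z e"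
      using z padic_tendsto_iff[OF prime_gt_1_nat[OF p] padic_of_rat_carrier[OF p val[of t]], of z]
      by simp
    then show "z = padic_of_rat p (- bernoulli_euler p (m t))"
      by auto
  qed
qed


section \<open>The local factors\<close>

lemma finite_padic_support:
  assumes "r \<noteq> 0"
  shows "finite {p. prime p \<and> padic_ord_rat p r \<noteq> 0}"
proof -
  obtain a b where ab: "r = of_int a / of_int b" "b > 0"
    by (rule rat_as_fraction)
  then have nz: "a \<noteq> 0" "b \<noteq> 0"
    using assms by auto
  have "int p dvd a * b" if "prime p" "padic_ord_rat p r \<noteq> 0" for p
    using padic_ord_rat_divide[OF that(1) nz] that(2) ab not_dvd_imp_multiplicity_0[of "int p"]
    by (cases "int p dvd a"; cases "int p dvd b") auto
  then have "{p. prime p \<and> padic_ord_rat p r \<noteq> 0} \<subseteq> nat ` {d. d dvd a * b}"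
    by (auto intro!: image_eqI[where x = "int p" for p])
  moreover have "finite {d. d dvd a * b}"
    using nz by simp
  ultimately show ?thesis
    by (meson finite_imageI finite_subset)
qed

lemma irregular_pairs_1_iff:
  "(p, l) \<in> irregular_pairs 1 \<longleftrightarrow> prime p \<and> odd p \<and>
     ppow_dvd_rat p 1 (bernoulli l / of_nat l) \<and> 2 \<le> l \<and> l < p - 1 \<and> even l"
  by (auto simp: irregular_pairs_def totient_prime)

text \<open>Pairs are defined by B_l / l and primes by B_l; as 0 < l < p, the divisor l is a p-unit.
  This gives access to the hypotheses, which speak of irregular primes.\<close>

lemma irregular_pair_imp_irregular_prime:
  assumes "(p, l) \<in> irregular_pairs 1"
  shows "irregular_prime p"
proof -
  have p: "prime p" "odd p" and l: "2 \<le> l" "l < p - 1" "even l"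
    and dvd: "ppow_dvd_rat p 1 (bernoulli l / of_nat l)"
    using assms unfolding irregular_pairs_1_iff by auto
  have "\<not> int p dvd int l"
    using l by (auto dest: dvd_imp_le)
  then have "ppow_dvd_rat p 1 (bernoulli l)"
    using ppow_dvd_rat_int_mult_iff[OF p(1), of "int l" 1 "bernoulli l / of_nat l"] dvd l by simp
  moreover have "l \<le> p - 3"
    using l p by presburger
  ultimately show ?thesis
    using p l unfolding irregular_prime_def by blast
qed

text \<open>Kummer's congruence for e = 1, where the totient is p - 1, carries divisibility by p
  between n and l. That p - 1 does not divide the even number n excludes p = 2; so p - 1 is even and
  l is even like n.\<close>

lemma ppow_dvd_bernoulli_mod:
  assumes p: "prime p" and n: "even n" "\<not> (p - 1) dvd n"
  defines "l \<equiv> n mod (p - 1)"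
  shows "(p, l) \<in> irregular_pairs 1 \<longleftrightarrow> ppow_dvd_rat p 1 (bernoulli n / of_nat n)"
    and "ppow_dvd_rat p 0 (bernoulli n / of_nat n)"
    and "\<not> (p - 1) dvd l" "n \<ge> 2"
proof -
  have "p \<noteq> 2"
    using n by auto
  then have odd: "odd p"
    using p prime_odd_nat prime_ge_2_nat[OF p] by auto
  then have "even (p - 1)"
    by simp
  then have l: "even l"
    using n(1) unfolding l_def by (simp add: dvd_mod)
  have lpos: "l \<noteq> 0"
    using n(2) by (simp add: l_def dvd_eq_mod_eq_0)
  have lt: "l < p - 1"
    using prime_gt_1_nat[OF p] by (simp add: l_def)
  have l2: "2 \<le> l"
    using l lpos by presburger
  show ndvd: "\<not> (p - 1) dvd l"
    using lpos lt by (auto dest: dvd_imp_le)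
  show n2: "n \<ge> 2"
    using n by (cases "n = 0 \<or> n = 1") auto
  have "[n = l] (mod totient (p ^ 1))"
    by (simp add: l_def cong_def totient_prime[OF p])
  from kummer_congruence[OF p n(2) ndvd this]
  have "ppow_dvd_rat p 1 (bernoulli_euler p n) \<longleftrightarrow> ppow_dvd_rat p 1 (bernoulli_euler p l)"
    by (rule ppow_dvd_rat_diff_iff[OF p])
  then show "(p, l) \<in> irregular_pairs 1 \<longleftrightarrow> ppow_dvd_rat p 1 (bernoulli n / of_nat n)"
    using p odd l l2 lt n2 unfolding irregular_pairs_1_iff by (simp add: ppow_dvd_bernoulli_euler_iff)
  show "ppow_dvd_rat p 0 (bernoulli n / of_nat n)"
    using bernoulli_euler_integral[OF p n(2)] n2 by (simp add: ppow_dvd_bernoulli_euler_iff[OF p])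
qed

theorem theorem3p6:
  fixes n :: nat
  assumes Delta_nonzero:
      "\<And>p l. \<lbrakk>irregular_prime p; (p, l) \<in> irregular_pairs 1\<rbrakk> \<Longrightarrow> irregular_Delta 1 p l \<noteq> 0"
    and index_const:
      "\<And>p k. \<lbrakk>irregular_prime p; k \<ge> 1\<rbrakk> \<Longrightarrow> irregularity_index k p = irregularity_index 1 p"
    and unique_zero:
      "\<And>p l. \<lbrakk>irregular_prime p; (p, l) \<in> irregular_pairs 1\<rbrakk> \<Longrightarrow>
         {s \<in> carrier (Zp p). padic_zeta p l s = \<zero>\<^bsub>Zp p\<^esub>} = {irregular_chi p l}"
    and isometry:
      "\<And>p l s t. \<lbrakk>irregular_prime p; (p, l) \<in> irregular_pairs 1;
                   s \<in> carrier (Zp p); t \<in> carrier (Zp p)\<rbrakk> \<Longrightarrow>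
         padic_abs p (padic_zeta p l s \<ominus>\<^bsub>Zp p\<^esub> padic_zeta p l t) =
         padic_abs p (padic_of_rat p (of_nat p) \<otimes>\<^bsub>Zp p\<^esub> (s \<ominus>\<^bsub>Zp p\<^esub> t))"
    and n: "even n" "n > 0"
  shows "of_rat (bernoulli n) =
    (-1) ^ (n div 2 - 1) *
    (\<Prod>p. if prime p \<and> \<not> (p - 1) dvd n then inverse (padic_abs_rat p (of_nat n)) else 1) *
    (\<Prod>(p, l) \<in> {(p, l). (p, l) \<in> irregular_pairs 1 \<and> [n = l] (mod (p - 1))}.
       inverse (padic_abs p (padic_of_rat p (of_nat p) \<otimes>\<^bsub>Zp p\<^esub>
         (irregular_chi p l \<ominus>\<^bsub>Zp p\<^esub>
            padic_of_rat p ((of_nat n - of_nat l) / (of_nat p - 1)))))) *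
    (\<Prod>p \<in> {p. prime p \<and> (p - 1) dvd n}. inverse (real p))"
proof -
  define B where "B = bernoulli n"
  define b where "b = B / of_nat n"
  \<comment> \<open>In an irregular pair l < p - 1, so the congruence with n forces l = n mod (p -
    1): the pairs in the product are indexed by their primes.\<close>
  define Q where "Q = {p. (p, n mod (p - 1)) \<in> irregular_pairs 1}"
  define D where "D = {p. prime p \<and> (p - 1) dvd n}"
  define supp where "supp r = {p. prime p \<and> padic_ord_rat p r \<noteq> 0}" for r
  \<comment> \<open>One finite index set for all products: at a prime outside F the numbers B, n and
    b are units, and p - 1 does not divide n.\<close>
  define F where "F = D \<union> supp B \<union> supp (of_nat n) \<union> supp b"
  define g where "g = (\<lambda>(p, l). inverse (padic_abs p (padic_of_rat p (of_nat p) \<otimes>\<^bsub>Zp p\<^esub>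
         (irregular_chi p l \<ominus>\<^bsub>Zp p\<^esub> padic_of_rat p ((of_nat n - of_nat l) / (of_nat p - 1))))))"
  have sign: "(-1) ^ (n div 2 - 1) * B > 0"
    unfolding B_def by (rule bernoulli_sign[OF n])
  then have B0: "B \<noteq> 0" and b0: "b \<noteq> 0" and Bb: "B = of_nat n * b"
    using n by (auto simp: b_def)
  have Q: "prime p" "\<not> (p - 1) dvd n" if "p \<in> Q" for p
    using that unfolding Q_def mem_Collect_eq irregular_pairs_1_iff by (auto simp: dvd_eq_mod_eq_0)
  have D_fin: "finite D"
  proof (rule finite_subset)
    show "D \<subseteq> {..Suc n}"
      using n by (auto simp: D_def dest!: dvd_imp_le)
  qed simp
  have F: "finite F" "p \<in> F \<Longrightarrow> prime p" for p
    using D_fin finite_padic_support[OF B0] finite_padic_support[of "of_nat n"] n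
      finite_padic_support[OF b0]
    by (auto simp: F_def D_def supp_def)
  have QF: "Q \<subseteq> F - D"
  proof
    fix p
    assume p: "p \<in> Q"
    then have "ppow_dvd_rat p 1 b"
      using ppow_dvd_bernoulli_mod(1)[OF Q(1)[OF p] n(1) Q(2)[OF p]] by (simp add: Q_def b_def B_def)
    then have "p \<in> supp b"
      using b0 Q(1)[OF p] by (auto simp: ppow_dvd_rat_def supp_def)
    then show "p \<in> F - D"
      using Q(2)[OF p] by (simp add: F_def D_def)
  qed
  have unit: "padic_abs_rat p b = 1" if p: "p \<in> F - D - Q" for p
  proof -
    have "prime p" "\<not> (p - 1) dvd n"
      using p F(2) by (auto simp: D_def)
    then have "ppow_dvd_rat p 0 b" "\<not> ppow_dvd_rat p 1 b"
      using ppow_dvd_bernoulli_mod[of p n] n p by (auto simp: Q_def b_def B_def)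
    then have "padic_ord_rat p b = 0"
      using b0 by (simp add: ppow_dvd_rat_def)
    then show ?thesis
      using b0 by (simp add: padic_abs_rat_def)
  qed
  have irr: "padic_abs_rat p b = inverse (g (p, n mod (p - 1)))" if p: "p \<in> Q" for p
  proof -
    define l where "l = n mod (p - 1)"
    define t where "t = n div (p - 1)"
    have pl: "(p, l) \<in> irregular_pairs 1"
      using p by (simp add: Q_def l_def)
    have prime: "prime p" and ndvd: "\<not> (p - 1) dvd l" and n2: "n \<ge> 2"
      using ppow_dvd_bernoulli_mod[OF Q(1)[OF p] n(1) Q(2)[OF p]] Q(1)[OF p] by (simp_all add: l_def)
    have irreg: "irregular_prime p"
      by (rule irregular_pair_imp_irregular_prime[OF pl])
    \<comment> \<open>The argument (n - l) / (p - 1) is thus a natural number, where the zeta value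
      is known.\<close>
    have n_eq: "n = l + (p - 1) * t"
      by (simp add: l_def t_def)
    have "(of_nat n - of_nat l) / (of_nat p - 1) = (of_nat t :: rat)"
      using prime_gt_1_nat[OF prime] by (subst n_eq) (simp add: of_nat_diff)
    then have g: "g (p, l) = inverse (padic_abs p (padic_of_rat p (of_nat p) \<otimes>\<^bsub>Zp p\<^esub>
         (irregular_chi p l \<ominus>\<^bsub>Zp p\<^esub> padic_of_rat p (of_nat t))))"
      by (simp add: g_def)
    have int: "ppow_dvd_rat p 0 (bernoulli_euler p n)"
      by (rule bernoulli_euler_integral[OF prime Q(2)[OF p]])
    then have int': "ppow_dvd_rat p 0 (- bernoulli_euler p n)"
      by (simp only: ppow_dvd_rat_minus_iff[OF prime])
    have "ppow_dvd_rat p 0 (of_nat t)"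
      using ppow_dvd_rat_of_int_iff[OF prime, of 0 "int t"] by simp
    then have t: "padic_of_rat p (of_nat t) \<in> carrier (Zp p)"
      by (rule padic_of_rat_carrier[OF prime])
    have zeta_t: "padic_zeta p l (padic_of_rat p (of_nat t)) = padic_of_rat p (- bernoulli_euler p n)"
      using padic_zeta_of_nat[OF prime ndvd, of t] n_eq by simp
    have chi: "irregular_chi p l \<in> carrier (Zp p)" "padic_zeta p l (irregular_chi p l) = \<zero>\<^bsub>Zp p\<^esub>"
      using unique_zero[OF irreg pl] by auto
    have zero: "\<zero>\<^bsub>Zp p\<^esub> = padic_of_rat p 0"
      using padic_of_rat_eq_0_iff[OF prime, of 0] by (auto simp: Zp_simps)
    \<comment> \<open>The isometry is applied to chi and t. The value at chi is 0, so the difference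
      of the two values is the Bernoulli quotient with its Euler factor, with positive sign.\<close>
    have "inverse (g (p, l)) = padic_abs p (padic_of_rat p 0 \<ominus>\<^bsub>Zp p\<^esub> padic_of_rat p (- bernoulli_euler p n))"
      unfolding g using isometry[OF irreg pl chi(1) t] by (simp add: chi(2) zeta_t zero)
    also have "\<dots> = padic_abs_rat p (bernoulli_euler p n)"
      using padic_of_rat_diff[OF prime _ int', of 0] padic_abs_of_rat[OF prime int] by simp
    also have "\<dots> = padic_abs_rat p b"
      using padic_abs_bernoulli_euler[OF prime n2] by (simp add: b_def B_def)
    finally show ?thesis
      by (simp add: l_def)
  qed
  have "of_rat \<bar>B\<bar> = (\<Prod>p\<in>F. inverse (padic_abs_rat p B))"
    by (rule prod_prime_powi_padic_ord_rat[OF B0 F]) (auto simp: F_def supp_def)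
  also have "\<dots> = (\<Prod>p\<in>F - D. inverse (padic_abs_rat p B)) * (\<Prod>p\<in>D. inverse (padic_abs_rat p B))"
    by (rule prod.subset_diff) (use F in \<open>auto simp: F_def\<close>)
  also have "(\<Prod>p\<in>D. inverse (padic_abs_rat p B)) = (\<Prod>p\<in>D. inverse (real p))"
    using von_staudt_clausen[OF _ _ n] B0
    by (intro prod.cong) (simp_all add: D_def B_def padic_abs_rat_def)
  \<comment> \<open>The factorisation B = n b is used only off D; on D the valuation of B itself is
    known.\<close>
  also have "(\<Prod>p\<in>F - D. inverse (padic_abs_rat p B)) =
      (\<Prod>p\<in>F - D. inverse (padic_abs_rat p (of_nat n)) * inverse (padic_abs_rat p b))"
    using F(2) by (intro prod.cong) (simp_all add: Bb padic_abs_rat_mult)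
  also have "\<dots> = (\<Prod>p\<in>F - D. inverse (padic_abs_rat p (of_nat n))) * (\<Prod>p\<in>F - D. inverse (padic_abs_rat p b))"
    by (rule prod.distrib)
  also have "(\<Prod>p\<in>F - D. inverse (padic_abs_rat p (of_nat n))) =
      (\<Prod>p. if prime p \<and> \<not> (p - 1) dvd n then inverse (padic_abs_rat p (of_nat n)) else 1)"
  proof -
    \<comment> \<open>A factor of the product over all p can differ from 1 only at a prime dividing
      n and outside D.\<close>
    have "{p. (if prime p \<and> \<not> (p - 1) dvd n then inverse (padic_abs_rat p (of_nat n)) else 1) \<noteq> 1} \<subseteq> F - D"
      using n by (auto simp: F_def D_def supp_def padic_abs_rat_def split: if_splits)
    with F(1) have "(\<Prod>p. if prime p \<and> \<not> (p - 1) dvd n then inverse (padic_abs_rat p (of_nat n)) else 1) =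
        (\<Prod>p\<in>F - D. if prime p \<and> \<not> (p - 1) dvd n then inverse (padic_abs_rat p (of_nat n)) else 1)"
      by (intro Prod_any.expand_superset) auto
    also have "\<dots> = (\<Prod>p\<in>F - D. inverse (padic_abs_rat p (of_nat n)))"
      using F(2) by (intro prod.cong) (auto simp: D_def)
    finally show ?thesis
      by simp
  qed
  also have "(\<Prod>p\<in>F - D. inverse (padic_abs_rat p b)) = (\<Prod>p\<in>Q. inverse (padic_abs_rat p b))"
    by (rule prod.mono_neutral_right) (use F QF unit in auto)
  also have "\<dots> = (\<Prod>p\<in>Q. g (p, n mod (p - 1)))"
    using irr by simp
  also have "\<dots> = prod g ((\<lambda>p. (p, n mod (p - 1))) ` Q)"
    by (subst prod.reindex) (auto simp: inj_on_def)
  also have "(\<lambda>p. (p, n mod (p - 1))) ` Q = {(p, l). (p, l) \<in> irregular_pairs 1 \<and> [n = l] (mod (p - 1))}"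
    unfolding Q_def irregular_pairs_1_iff by (auto simp: cong_def)
  finally have abs: "of_rat \<bar>B\<bar> =
      (\<Prod>p. if prime p \<and> \<not> (p - 1) dvd n then inverse (padic_abs_rat p (of_nat n)) else 1) *
      prod g {(p, l). (p, l) \<in> irregular_pairs 1 \<and> [n = l] (mod (p - 1))} *
      (\<Prod>p\<in>D. inverse (real p))" .
  have "B = (-1) ^ (n div 2 - 1) * \<bar>B\<bar>"
    using sign by (cases "even (n div 2 - 1)") auto
  then have "real_of_rat B = of_rat ((-1) ^ (n div 2 - 1)) * of_rat \<bar>B\<bar>"
    by (metis of_rat_mult)
  also have "real_of_rat ((-1) ^ (n div 2 - 1)) = (-1) ^ (n div 2 - 1)"
    by (simp add: of_rat_power of_rat_minus)
  finally show ?thesis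
    unfolding abs by (simp only: B_def g_def D_def mult.assoc)
qed

end
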